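(* Let $p>3$ be a prime. Then $$\sum_{n=0}^{p-1}\frac{Q_n}{(-6)^n}\equiv\sum_{n=0}^{p-1}\frac{Q_n}{(-12)^n}\equiv\begin{cases}2u\pmod p&\text{if }3\mid p-1,\ p=u^2+3v^2\text{ with integers }u,v\text{ and }3\mid u-1,\\0\pmod p&\text{if }p\equiv2\pmod3.\end{cases}$$
   Context: $f_n=\sum_{k=0}^n\binom nk^3$ and $Q_n=\sum_{k=0}^n\binom nk(-8)^{n-k}f_k$. Congruences are in the ring of rationals with denominator prime to $p$. *)

theory Defs
  imports "HOL-Number_Theory.Number_Theory"
begin

definition franel :: "nat \<Rightarrow> int" where
  "franel n = (\<Sum>k=0..n. int (n choose k) ^ 3)"

definition Q :: "nat \<Rightarrow> int" where
  "Q n = (\<Sum>k=0..n. int (n choose k) * (-8) ^ (n - k) * franel k)"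

(* quotient_of returns the fraction in lowest terms with positive denominator. *)
definition p_integral :: "nat \<Rightarrow> rat set" where
  "p_integral p = {x. coprime (snd (quotient_of x)) (int p)}"

(* Congruence modulo p in the ring p_integral p. The constant cong of the library is of no use
   here: in the field of rationals everything is congruent modulo a nonzero p. *)
definition rat_cong :: "rat \<Rightarrow> rat \<Rightarrow> nat \<Rightarrow> bool" where
  "rat_cong x y p \<longleftrightarrow>
     x \<in> p_integral p \<and> y \<in> p_integral p \<and> (\<exists>z\<in>p_integral p. x - y = of_nat p * z)"

end

theory Submission
  imports Defs
begin

text \<open>
  With \<open>P = (1 + x) (1 + y) (1 + 1/(x y))\<close>, the constant terms of \<open>P\<^sup>n\<close> and \<open>(P - 8)\<^sup>n\<close> are
  \<open>f\<^sub>n\<close> and \<open>Q\<^sub>n\<close>. Summing over all nonzero residues \<open>x\<close>, \<open>y\<close> extracts these constant terms modulo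
  \<open>p\<close> (with an extra contribution 6 from the corners of the Newton polygon when \<open>n = p - 1\<close>),
  while the geometric sum of \<open>((P - 8)/m)\<^sup>n\<close> is an indicator modulo \<open>p\<close>. So
  the sum of \<open>Q\<^sub>n/m\<^sup>n\<close> counts points on the curve \<open>P = c\<close> with \<open>c = m + 8\<close>, which elementary
  substitutions turn into a character sum over a cubic. Both \<open>c = 2\<close> and \<open>c = -4\<close> lead
  to \<open>-\<phi>(1)\<close>, where \<open>\<phi>(a)\<close> is the sum of the Legendre symbols of \<open>x\<^sup>3 + a\<close>.
  For \<open>p \<equiv> 2\<close> modulo 3 cubing is bijective and \<open>\<phi>(1) = 0\<close>. Otherwise \<open>\<psi>(a) = \<chi>(a) \<phi>(a)\<close> only depends on
  the class of \<open>a\<close> modulo cubes, and the first two moments of \<open>\<psi>\<close> show that its three values have sum 0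
  and sum of squares \<open>6 p\<close>, which gives \<open>p = l\<^sup>2 + 3 v\<^sup>2\<close> with \<open>2 l = \<phi>(1)\<close>.
\<close>

section \<open>Residues modulo an odd prime and the Legendre symbol\<close>

locale odd_prime =
  fixes p :: nat
  assumes prime_p: "prime p" and p_gt_2: "p > 2"
begin

abbreviation cong_p :: "int \<Rightarrow> int \<Rightarrow> bool" (infix "\<simeq>" 50) where
  "x \<simeq> y \<equiv> [x = y] (mod int p)"

abbreviation R :: "int set" where "R \<equiv> {0..<int p}"
abbreviation U :: "int set" where "U \<equiv> {1..<int p}"

definition \<chi> :: "int \<Rightarrow> int" where "\<chi> a = Legendre a (int p)"

text \<open>Functions on residue classes are encoded as integer functions constant on each class.
  This lets a sum over \<open>R\<close> be reindexed by a map that leaves \<open>R\<close>.\<close>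

definition periodic :: "(int \<Rightarrow> int) \<Rightarrow> bool" where
  "periodic F \<longleftrightarrow> (\<forall>x y. x \<simeq> y \<longrightarrow> F x = F y)"

lemma periodicI: "(\<And>x y. x \<simeq> y \<Longrightarrow> F x = F y) \<Longrightarrow> periodic F"
  by (simp add: periodic_def)

lemma periodicD: "periodic F \<Longrightarrow> x \<simeq> y \<Longrightarrow> F x = F y"
  by (simp add: periodic_def)

lemma prime_int_p: "prime (int p)"
  using prime_p by simp

lemma R_eq: "R = insert 0 U"
  using p_gt_2 by auto

lemma sum_R: "(\<Sum>x\<in>R. F x) = F 0 + (\<Sum>x\<in>U. F x :: int)"
  by (subst R_eq) simp

lemma cong_0_R: "x \<in> R \<Longrightarrow> x \<simeq> 0 \<longleftrightarrow> x = 0"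
  using p_gt_2 by (auto simp: cong_def)

lemma cong_R_eq: "x \<in> R \<Longrightarrow> y \<in> R \<Longrightarrow> x \<simeq> y \<Longrightarrow> x = y"
  by (auto intro: cong_less_imp_eq_int)

lemma U_not_0: "x \<in> U \<Longrightarrow> \<not> x \<simeq> 0"
  using cong_0_R[of x] by auto

lemma cong_mult_0_iff: "a * b \<simeq> 0 \<longleftrightarrow> a \<simeq> 0 \<or> b \<simeq> 0"
  using prime_int_p by (simp add: cong_0_iff prime_dvd_mult_iff)

lemma cong_power_0_iff: "n > 0 \<Longrightarrow> a ^ n \<simeq> 0 \<longleftrightarrow> a \<simeq> 0"
  using prime_int_p by (simp add: cong_0_iff prime_dvd_power_iff)

lemma cong_mult_cancel: "\<not> c \<simeq> 0 \<Longrightarrow> c * a \<simeq> c * b \<Longrightarrow> a \<simeq> b"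
  using cong_mult_0_iff[of c "a - b"]
  by (simp add: cong_iff_dvd_diff algebra_simps)

lemma cong_square_iff: "x\<^sup>2 \<simeq> y\<^sup>2 \<longleftrightarrow> x \<simeq> y \<or> x \<simeq> - y"
proof -
  have "x\<^sup>2 - y\<^sup>2 = (x - y) * (x - (- y))"
    by (simp add: power2_eq_square algebra_simps)
  then show ?thesis
    using prime_int_p by (simp only: cong_iff_dvd_diff prime_dvd_mult_iff)
qed

lemma two_not_0: "\<not> 2 \<simeq> 0"
  using p_gt_2 by (simp add: cong_def)

lemma fermat_little: "\<not> x \<simeq> 0 \<Longrightarrow> x ^ (p - 1) \<simeq> 1"
proof -
  assume "\<not> x \<simeq> 0"
  then have "\<not> int p dvd x" by (simp add: cong_0_iff)
  then have "\<not> int p dvd x mod int p" by (simp add: dvd_mod_iff)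
  moreover have "x mod int p = int (nat (x mod int p))" using p_gt_2 by simp
  ultimately have *: "\<not> p dvd nat (x mod int p)" by (metis int_dvd_int_iff)
  have "[int (nat (x mod int p) ^ (p - 1)) = int 1] (mod int p)"
    using fermat_theorem[OF prime_p *] by (simp only: cong_int_iff)
  then have "(x mod int p) ^ (p - 1) \<simeq> 1" using p_gt_2 by simp
  then show ?thesis by (simp add: cong_def power_mod)
qed

text \<open>By Fermat, \<open>x ^ (p - 2)\<close> can serve as the inverse of \<open>x\<close>
  throughout, while all computation stays in the integers.\<close>

lemma mult_inverse_cong_1: "\<not> x \<simeq> 0 \<Longrightarrow> x * x ^ (p - 2) \<simeq> 1"
proof -
  assume "\<not> x \<simeq> 0"
  moreover have "x * x ^ (p - 2) = x ^ (p - 1)"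
    using p_gt_2 by (simp flip: power_Suc add: Suc_diff_Suc numeral_2_eq_2)
  ultimately show ?thesis using fermat_little by simp
qed

lemma chi_cong: "a \<simeq> b \<Longrightarrow> \<chi> a = \<chi> b"
  unfolding \<chi>_def Legendre_def QuadRes_def by (simp add: cong_def)

lemma chi_range: "\<chi> a \<in> {-1, 0, 1}"
  by (simp add: \<chi>_def Legendre_def)

lemma chi_euler: "\<chi> a \<simeq> a ^ ((p - 1) div 2)"
  unfolding \<chi>_def using euler_criterion[OF prime_p p_gt_2] .

text \<open>Euler's criterion makes both sides congruent modulo \<open>p\<close>. Both lie in {-1,
  0, 1}, so they differ by at most 2, which is less than \<open>p\<close>.\<close>

lemma chi_mult: "\<chi> (a * b) = \<chi> a * \<chi> b"
proof -
  have "\<chi> (a * b) \<simeq> \<chi> a * \<chi> b"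
    using chi_euler[of "a * b"] cong_mult[OF chi_euler[of a] chi_euler[of b]]
    by (simp add: power_mult_distrib cong_def)
  then have *: "int p dvd \<chi> (a * b) - \<chi> a * \<chi> b" by (simp add: cong_iff_dvd_diff)
  have le2: "\<bar>\<chi> (a * b) - \<chi> a * \<chi> b\<bar> \<le> 2"
    using chi_range[of "a * b"] chi_range[of a] chi_range[of b] by auto
  have "\<chi> (a * b) - \<chi> a * \<chi> b = 0"
  proof (rule ccontr)
    assume "\<chi> (a * b) - \<chi> a * \<chi> b \<noteq> 0"
    then have "\<bar>int p\<bar> \<le> \<bar>\<chi> (a * b) - \<chi> a * \<chi> b\<bar>" using * by (rule dvd_imp_le_int)
    with le2 show False using p_gt_2 by linarith
  qed
  then show ?thesis by simp
qed

lemma chi_eq_0_iff: "\<chi> a = 0 \<longleftrightarrow> a \<simeq> 0"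
  by (simp add: \<chi>_def Legendre_def)

lemma chi_square: "\<not> a \<simeq> 0 \<Longrightarrow> \<chi> (a\<^sup>2) = 1"
  using chi_range[of a] chi_eq_0_iff[of a] by (auto simp: power2_eq_square chi_mult)

lemma chi_square_mult: "\<not> a \<simeq> 0 \<Longrightarrow> \<chi> (a\<^sup>2 * b) = \<chi> b"
  by (simp add: chi_mult chi_square)

lemma chi_1: "\<chi> 1 = 1"
  using chi_square[of 1] p_gt_2 by (simp add: cong_def)

lemma chi_sq: "\<chi> a * \<chi> a = of_bool (\<not> a \<simeq> 0)"
  using chi_range[of a] chi_eq_0_iff[of a] by auto

section \<open>Sums over residues, roots of quadratics and quadratic character sums\<close>

lemma reindex:
  assumes F: "periodic F" and h: "\<And>x y. x \<in> R \<Longrightarrow> y \<in> R \<Longrightarrow> h x \<simeq> h y \<Longrightarrow> x \<simeq> y"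
  shows "(\<Sum>x\<in>R. F (h x)) = (\<Sum>x\<in>R. F x)"
proof -
  have inj: "inj_on (\<lambda>x. h x mod int p) R"
  proof (rule inj_onI)
    fix x y assume xy: "x \<in> R" "y \<in> R" and "h x mod int p = h y mod int p"
    then have "h x \<simeq> h y" by (simp only: cong_def)
    with xy show "x = y" by (blast intro: cong_R_eq h)
  qed
  \<comment> \<open>After reduction modulo \<open>p\<close>, \<open>h\<close> is an injective
    self-map of a finite set and hence a permutation.\<close>
  have "(\<lambda>x. h x mod int p) ` R \<subseteq> R" using p_gt_2 by auto
  then have im: "(\<lambda>x. h x mod int p) ` R = R"
    using inj by (intro endo_inj_surj) auto
  have "(\<Sum>x\<in>R. F (h x)) = (\<Sum>x\<in>R. F (h x mod int p))"
    by (intro sum.cong periodicD[OF F]) auto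
  also have "\<dots> = (\<Sum>x\<in>(\<lambda>x. h x mod int p) ` R. F x)"
    by (simp add: sum.reindex[OF inj])
  finally show ?thesis by (simp only: im)
qed

lemma reindex_affine:
  assumes "periodic F" "\<not> a \<simeq> 0"
  shows "(\<Sum>x\<in>R. F (a * x + b)) = (\<Sum>x\<in>R. F x)"
  using assms by (intro reindex) (auto simp: cong_add_rcancel dest: cong_mult_cancel)

lemma reindex_mult:
  assumes "periodic F" "\<not> a \<simeq> 0"
  shows "(\<Sum>x\<in>R. F (a * x)) = (\<Sum>x\<in>R. F x)"
  using reindex_affine[OF assms, of 0] by simp

lemma sum_indicator: "(\<Sum>x\<in>R. of_bool (a \<simeq> x) * G x) = (G (a mod int p) :: int)"
proof -
  have "(\<Sum>x\<in>R. of_bool (a \<simeq> x) * G x) = (\<Sum>x\<in>{a mod int p}. of_bool (a \<simeq> x) * G x)"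
    using p_gt_2 by (intro sum.mono_neutral_right) (auto simp: cong_def)
  then show ?thesis by simp
qed

lemma count_squares: "(\<Sum>y\<in>R. of_bool (y\<^sup>2 \<simeq> d)) = 1 + \<chi> d"
proof -
  consider "d \<simeq> 0" | y0 where "\<not> d \<simeq> 0" "y0\<^sup>2 \<simeq> d" | "\<not> d \<simeq> 0" "\<not> QuadRes (int p) d"
    unfolding QuadRes_def by blast
  then show ?thesis
  proof cases
    case 1
    then have "y\<^sup>2 \<simeq> d \<longleftrightarrow> 0 \<simeq> y" for y
      using cong_power_0_iff[of 2 y] by (auto simp: cong_def)
    then show ?thesis using sum_indicator[of 0 "\<lambda>_. 1"] 1 by (simp add: chi_eq_0_iff[THEN iffD2])
  next
    case 2
    have "y\<^sup>2 \<simeq> d \<longleftrightarrow> y \<simeq> y0 \<or> y \<simeq> - y0" for y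
      using 2 cong_square_iff[of y y0] by (auto simp: cong_def)
    moreover have "\<not> y0 \<simeq> - y0"
    proof
      assume "y0 \<simeq> - y0"
      then have "2 * y0 \<simeq> 0" by (simp add: cong_iff_dvd_diff)
      then have "y0 \<simeq> 0" using two_not_0 cong_mult_0_iff by blast
      then have "y0\<^sup>2 \<simeq> 0" by (simp add: cong_power_0_iff)
      then show False using 2 by (simp add: cong_def)
    qed
    ultimately have "of_bool (y\<^sup>2 \<simeq> d) = of_bool (y0 \<simeq> y) + (of_bool (- y0 \<simeq> y) :: int)" for y
      by (auto simp: cong_def)
    then have "(\<Sum>y\<in>R. of_bool (y\<^sup>2 \<simeq> d)) = (2 :: int)"
      using sum_indicator[of y0 "\<lambda>_. 1"] sum_indicator[of "- y0" "\<lambda>_. 1"] by (simp add: sum.distrib)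
    moreover have "\<chi> d = 1" using 2 by (auto simp: \<chi>_def Legendre_def QuadRes_def)
    ultimately show ?thesis by simp
  next
    case 3
    then show ?thesis by (auto simp: \<chi>_def Legendre_def QuadRes_def)
  qed
qed

text \<open>Completing the square: multiplication by \<open>4 * a\<close> turns the equation into
  one for the square of \<open>2 * a * y + b\<close>, which runs over all residues with
  \<open>y\<close>.\<close>

lemma count_quadratic:
  assumes "\<not> a \<simeq> 0"
  shows "(\<Sum>y\<in>R. of_bool (a * y\<^sup>2 + b * y + c \<simeq> 0)) = 1 + \<chi> (b\<^sup>2 - 4 * a * c)"
proof -
  have iff: "a * y\<^sup>2 + b * y + c \<simeq> 0 \<longleftrightarrow> ((2 * a) * y + b)\<^sup>2 \<simeq> b\<^sup>2 - 4 * a * c" for y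
  proof -
    have "((2 * a) * y + b)\<^sup>2 - (b\<^sup>2 - 4 * a * c) = (2 * 2 * a) * (a * y\<^sup>2 + b * y + c)"
      by (simp add: power2_eq_square algebra_simps)
    then have "((2 * a) * y + b)\<^sup>2 \<simeq> b\<^sup>2 - 4 * a * c \<longleftrightarrow> (2 * 2 * a) * (a * y\<^sup>2 + b * y + c) \<simeq> 0"
      by (simp add: cong_iff_dvd_diff)
    then show ?thesis using assms two_not_0 by (simp only: cong_mult_0_iff) simp
  qed
  have a2: "\<not> 2 * a \<simeq> 0" using assms two_not_0 by (simp add: cong_mult_0_iff)
  have per: "periodic (\<lambda>y. of_bool (y\<^sup>2 \<simeq> b\<^sup>2 - 4 * a * c))"
  proof (intro periodicI arg_cong[of _ _ of_bool])
    fix x y assume "x \<simeq> y"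
    then have "x\<^sup>2 \<simeq> y\<^sup>2" by (rule cong_pow)
    then show "(x\<^sup>2 \<simeq> b\<^sup>2 - 4 * a * c) = (y\<^sup>2 \<simeq> b\<^sup>2 - 4 * a * c)" by (simp add: cong_def)
  qed
  show ?thesis
    by (simp only: iff reindex_affine[OF per a2] count_squares)
qed

text \<open>The map \<open>r \<mapsto> r + d / r\<close> takes the value \<open>w\<close> exactly \<open>1 + \<chi> (w\<^sup>2 - 4 d)\<close> times.\<close>

lemma sum_plus_inverse:
  assumes G: "periodic G" and d: "\<not> d \<simeq> 0"
  shows "(\<Sum>r\<in>U. G (r + d * r ^ (p - 2))) = (\<Sum>w\<in>R. G w * (1 + \<chi> (w\<^sup>2 - 4 * d)))"
proof -
  have fib: "(\<Sum>r\<in>U. of_bool (r + d * r ^ (p - 2) \<simeq> w)) = 1 + \<chi> (w\<^sup>2 - 4 * d)" for w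
  proof -
    have "r + d * r ^ (p - 2) \<simeq> w \<longleftrightarrow> 1 * r\<^sup>2 + (- w) * r + d \<simeq> 0" if "r \<in> U" for r
    proof -
      have r: "\<not> r \<simeq> 0" using that by (rule U_not_0)
      have "r + d * r ^ (p - 2) \<simeq> w \<longleftrightarrow> r * (r + d * r ^ (p - 2)) \<simeq> r * w"
        using cong_mult_cancel[OF r] cong_scalar_left by blast
      also have "\<dots> \<longleftrightarrow> r\<^sup>2 + d * (r * r ^ (p - 2)) \<simeq> r * w"
        by (simp add: power2_eq_square algebra_simps)
      also have "\<dots> \<longleftrightarrow> r\<^sup>2 + d * 1 \<simeq> r * w"
      proof -
        have "r\<^sup>2 + d * (r * r ^ (p - 2)) \<simeq> r\<^sup>2 + d * 1"
          by (intro cong_add cong_mult mult_inverse_cong_1 r) auto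
        then show ?thesis by (simp add: cong_def)
      qed
      also have "\<dots> \<longleftrightarrow> 1 * r\<^sup>2 + (- w) * r + d \<simeq> 0"
        by (simp add: cong_iff_dvd_diff algebra_simps)
      finally show ?thesis .
    qed
    then have "(\<Sum>r\<in>U. of_bool (r + d * r ^ (p - 2) \<simeq> w))
        = (\<Sum>r\<in>U. of_bool (1 * r\<^sup>2 + (- w) * r + d \<simeq> 0) :: int)"
      by (intro sum.cong) auto
    \<comment> \<open>The term \<open>r = 0\<close> can be added because the quadratic takes the
      nonzero value \<open>d\<close> there.\<close>
    also have "\<dots> = (\<Sum>r\<in>R. of_bool (1 * r\<^sup>2 + (- w) * r + d \<simeq> 0))"
      using d by (subst sum_R) simp
    also have "\<dots> = 1 + \<chi> (w\<^sup>2 - 4 * d)"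
      using p_gt_2 by (subst count_quadratic) (simp_all add: cong_def)
    finally show ?thesis .
  qed
  have "(\<Sum>r\<in>U. G (r + d * r ^ (p - 2)))
      = (\<Sum>r\<in>U. \<Sum>w\<in>R. of_bool (r + d * r ^ (p - 2) \<simeq> w) * G w)"
    by (subst sum_indicator) (auto intro!: sum.cong periodicD[OF G])
  also have "\<dots> = (\<Sum>w\<in>R. \<Sum>r\<in>U. of_bool (r + d * r ^ (p - 2) \<simeq> w) * G w)"
    by (rule sum.swap)
  also have "\<dots> = (\<Sum>w\<in>R. G w * (1 + \<chi> (w\<^sup>2 - 4 * d)))"
    by (simp only: sum_distrib_right[symmetric] fib mult.commute[of "G _"])
  finally show ?thesis .
qed

text \<open>For the constant function 1, the two sides of \<open>sum_plus_inverse\<close> are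
  \<open>p - 1\<close> and \<open>p\<close> plus this sum.\<close>

lemma sum_chi_quadratic:
  assumes "\<not> d \<simeq> 0"
  shows "(\<Sum>w\<in>R. \<chi> (w\<^sup>2 - 4 * d)) = - 1"
proof -
  have "periodic (\<lambda>_. 1)" by (simp add: periodic_def)
  from sum_plus_inverse[OF this assms] show ?thesis using p_gt_2 by (simp add: sum.distrib)
qed

text \<open>Double counting of the pairs with \<open>y\<^sup>2 \<simeq> x\<close>: there are
  \<open>p\<close> of them by \<open>y\<close>, and \<open>p\<close> plus this sum by
  \<open>x\<close>.\<close>

lemma sum_chi: "(\<Sum>x\<in>R. \<chi> x) = 0"
proof -
  have "(\<Sum>x\<in>R. \<Sum>y\<in>R. of_bool (y\<^sup>2 \<simeq> x)) = (\<Sum>y\<in>R. \<Sum>x\<in>R. of_bool (y\<^sup>2 \<simeq> x) * (1::int))"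
    by (subst sum.swap) simp
  also have "\<dots> = int p" by (subst sum_indicator) simp
  finally show ?thesis by (simp add: count_squares sum.distrib)
qed


lemmas cong_intros = cong_refl cong_add cong_diff cong_mult cong_pow

lemma chi_cube: "\<chi> (a ^ 3) = \<chi> a"
  using chi_range[of a] by (auto simp: power3_eq_cube chi_mult)

lemma sum_chi_square: "(\<Sum>w\<in>R. \<chi> (w\<^sup>2)) = int p - 1"
proof -
  have "(\<Sum>w\<in>R. \<chi> (w\<^sup>2)) = \<chi> 0 + (\<Sum>w\<in>U. 1)"
    by (simp only: sum_R) (simp add: chi_square U_not_0)
  then show ?thesis using p_gt_2 by (simp add: chi_eq_0_iff)
qed

text \<open>Multiplication by the square 16 brings the quadratic into the shape
  \<open>w\<^sup>2 - 4 * d\<close> of \<open>sum_chi_quadratic\<close>, where \<open>d\<close> is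
  its discriminant. If \<open>d\<close> vanishes modulo \<open>p\<close>, only squares are
  summed.\<close>

lemma sum_chi_quadratic_general:
  "(\<Sum>a\<in>R. \<chi> (a\<^sup>2 + b * a + c)) = int p * of_bool (b\<^sup>2 - 4 * c \<simeq> 0) - 1"
proof -
  define d where "d = b\<^sup>2 - 4 * c"
  have 4: "\<not> 4 \<simeq> 0" using two_not_0 cong_mult_0_iff[of 2 2] by simp
  have per: "periodic (\<lambda>w. \<chi> (w\<^sup>2 - 4 * d))"
    by (intro periodicI chi_cong cong_intros)
  have eq: "\<chi> (a\<^sup>2 + b * a + c) = \<chi> ((4 * a + 2 * b)\<^sup>2 - 4 * d)" for a
  proof -
    have "(4 * a + 2 * b)\<^sup>2 - 4 * d = 4\<^sup>2 * (a\<^sup>2 + b * a + c)"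
      by (simp add: d_def power2_eq_square algebra_simps)
    then show ?thesis by (simp only: chi_square_mult[OF 4])
  qed
  have "(\<Sum>a\<in>R. \<chi> (a\<^sup>2 + b * a + c)) = (\<Sum>w\<in>R. \<chi> (w\<^sup>2 - 4 * d))"
    by (simp only: eq reindex_affine[OF per 4])
  also have "\<dots> = int p * of_bool (d \<simeq> 0) - 1"
  proof (cases "d \<simeq> 0")
    case True
    then have "w\<^sup>2 - 4 * d \<simeq> w\<^sup>2 - 4 * 0" for w
      by (intro cong_intros)
    then have "\<chi> (w\<^sup>2 - 4 * d) = \<chi> (w\<^sup>2)" for w
      using chi_cong[of "w\<^sup>2 - 4 * d" "w\<^sup>2"] by simp
    then show ?thesis using True by (simp add: sum_chi_square)
  next
    case False
    then show ?thesis by (simp add: sum_chi_quadratic)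
  qed
  finally show ?thesis by (simp only: d_def)
qed

text \<open>Inversion, extended by fixing the class of 0, thus permutes the residues and can be used
  in \<open>reindex\<close>.\<close>

lemma inverse_inj:
  assumes "x ^ (p - 2) \<simeq> y ^ (p - 2)"
  shows "x \<simeq> y"
proof (cases "x \<simeq> 0 \<or> y \<simeq> 0")
  case True
  have "x ^ (p - 2) \<simeq> 0 \<longleftrightarrow> y ^ (p - 2) \<simeq> 0"
    using assms by (simp add: cong_def)
  then have "x \<simeq> 0" "y \<simeq> 0" using True p_gt_2 by (auto simp: cong_power_0_iff)
  then show ?thesis by (simp add: cong_def)
next
  case False
  then have "x * 1 \<simeq> x * (y * y ^ (p - 2))"
    by (intro cong_mult cong_sym[OF mult_inverse_cong_1]) auto
  also have "x * (y * y ^ (p - 2)) \<simeq> y * (x * x ^ (p - 2))"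
    using cong_scalar_left[OF cong_sym[OF assms], of "x * y"] by (simp add: algebra_simps)
  also have "y * (x * x ^ (p - 2)) \<simeq> y * 1"
    using False by (intro cong_mult mult_inverse_cong_1) auto
  finally show ?thesis by simp
qed

section \<open>Cubic character sums attached to the curves \<open>P = c\<close>\<close>

definition \<Phi> :: "int \<Rightarrow> int" where
  "\<Phi> c = (\<Sum>s\<in>R. \<chi> ((1 - 4 * s) * ((1 - c * s)\<^sup>2 - 4 * s)))"

text \<open>By \<open>count_squares\<close>, the curve y^2 = x^3 + a has \<open>p + \<phi> a\<close>
  affine points modulo \<open>p\<close>.\<close>

definition \<phi> :: "int \<Rightarrow> int" where
  "\<phi> a = (\<Sum>x\<in>R. \<chi> (x ^ 3 + a))"

text \<open>The argument of \<open>\<chi>\<close> is the discriminant of \<open>P x y = c\<close> as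
  a quadratic in \<open>y\<close>. Divided by x^2 it depends only on w = x + 1/x, so
  \<open>sum_plus_inverse\<close> splits the sum. One part is a quadratic character sum in w; the
  other becomes \<open>\<Phi> c\<close> up to its term at 0, via w + 2 = 1/s.\<close>

lemma sum_chi_discriminant:
  assumes c: "\<not> c + 1 \<simeq> 0"
  shows "(\<Sum>x\<in>R. \<chi> (((1 + x)\<^sup>2 - c * x)\<^sup>2 - 4 * x * (1 + x)\<^sup>2)) = \<Phi> c - 1"
proof -
  let ?D = "\<lambda>x. ((1 + x)\<^sup>2 - c * x)\<^sup>2 - 4 * x * (1 + x)\<^sup>2"
  define G where "G w = \<chi> ((w + 2 - c)\<^sup>2 - 4 * (w + 2))" for w
  define F where "F z = \<chi> (((z - c)\<^sup>2 - 4 * z) * (z * (z - 4)))" for z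
  have perG: "periodic G" unfolding G_def
    by (intro periodicI chi_cong cong_intros)
  have perF: "periodic F" unfolding F_def
    by (intro periodicI chi_cong cong_intros)
  have one: "\<not> 1 \<simeq> 0" using p_gt_2 by (simp add: cong_def)
  have DG: "\<chi> (?D x) = G (x + 1 * x ^ (p - 2))" if "x \<in> U" for x
  proof -
    have x: "\<not> x \<simeq> 0" using that by (rule U_not_0)
    define i where "i = x ^ (p - 2)"
    have t: "1 \<simeq> x * i" unfolding i_def using mult_inverse_cong_1[OF x] by (rule cong_sym)
    have "?D x = (x\<^sup>2 + 1 + 2 * x - c * x)\<^sup>2 - 4 * x * (x\<^sup>2 + 1 + 2 * x)"
      by (simp add: power2_eq_square algebra_simps)
    \<comment> \<open>Writing 1 as \<open>x * i\<close> lets the square \<open>x\<^sup>2\<close> be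
      factored out.\<close>
    also have "\<dots> \<simeq> (x\<^sup>2 + x * i + 2 * x - c * x)\<^sup>2 - 4 * x * (x\<^sup>2 + x * i + 2 * x)"
      (is "_ \<simeq> ?B")
      by (intro cong_intros t)
    also have "?B = x\<^sup>2 * ((x + 1 * i + 2 - c)\<^sup>2 - 4 * (x + 1 * i + 2))"
      by (simp add: power2_eq_square algebra_simps)
    finally show ?thesis
      unfolding G_def i_def[symmetric] by (metis chi_cong chi_square_mult[OF x])
  qed
  have sumG: "(\<Sum>w\<in>R. G w) = - 1"
  proof -
    have "G w = \<chi> (w\<^sup>2 + (- 2 * c) * w + (c\<^sup>2 - 4 * c - 4))" for w
      unfolding G_def by (simp add: power2_eq_square algebra_simps)
    then have "(\<Sum>w\<in>R. G w) = int p * of_bool ((- 2 * c)\<^sup>2 - 4 * (c\<^sup>2 - 4 * c - 4) \<simeq> 0) - 1"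
      by (simp only: sum_chi_quadratic_general)
    \<comment> \<open>The discriminant of the quadratic in \<open>w\<close> is nonzero exactly by
      the hypothesis on \<open>c + 1\<close>.\<close>
    moreover have "(- 2 * c)\<^sup>2 - 4 * (c\<^sup>2 - 4 * c - 4) = 2 ^ 4 * (c + 1)"
      by (simp add: power2_eq_square algebra_simps)
    moreover have "\<not> 2 ^ 4 * (c + 1) \<simeq> 0"
      using c two_not_0 by (simp only: cong_mult_0_iff cong_power_0_iff) simp
    ultimately show ?thesis by simp
  qed
  have "(\<Sum>w\<in>R. G w * \<chi> (w\<^sup>2 - 4 * 1)) = (\<Sum>w\<in>R. F (1 * w + 2))"
  proof (rule sum.cong)
    fix w :: int
    have "(1 * w + 2) * (1 * w + 2 - 4) = w\<^sup>2 - 4 * 1"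
      by (simp add: power2_eq_square algebra_simps)
    then show "G w * \<chi> (w\<^sup>2 - 4 * 1) = F (1 * w + 2)"
      unfolding G_def F_def by (simp only: chi_mult[symmetric] mult_1)
  qed simp
  also have "\<dots> = (\<Sum>z\<in>R. F z)" by (rule reindex_affine[OF perF one])
  \<comment> \<open>The quartic in \<open>F\<close> has the root 0; the inversion z = 1/s sends this
    root to infinity and leaves a cubic in \<open>s\<close>.\<close>
  also have "\<dots> = (\<Sum>s\<in>R. F (s ^ (p - 2)))"
    by (rule reindex[OF perF inverse_inj, symmetric])
  also have "\<dots> = F 0 + (\<Sum>s\<in>U. F (s ^ (p - 2)))"
    using p_gt_2 by (simp only: sum_R) (simp add: power_0_left)
  also have "(\<Sum>s\<in>U. F (s ^ (p - 2))) = (\<Sum>s\<in>U. \<chi> ((1 - 4 * s) * ((1 - c * s)\<^sup>2 - 4 * s)))"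
  proof (rule sum.cong)
    fix s assume "s \<in> U"
    then have s: "\<not> s \<simeq> 0" by (rule U_not_0)
    then have s2: "\<not> s\<^sup>2 \<simeq> 0" by (simp add: cong_power_0_iff)
    define i where "i = s ^ (p - 2)"
    have t: "1 \<simeq> s * i" unfolding i_def using mult_inverse_cong_1[OF s] by (rule cong_sym)
    have "(1 - 4 * s) * ((1 - c * s)\<^sup>2 - 4 * s) = (1 * (1 - 4 * s)) * ((1 - c * s)\<^sup>2 - 4 * (1 * s))"
      by simp
    also have "\<dots> \<simeq> ((s * i) * (s * i - 4 * s)) * ((s * i - c * s)\<^sup>2 - 4 * (s * i * s))"
      (is "_ \<simeq> ?B")
      by (intro cong_intros t)
    also have "?B = (s\<^sup>2)\<^sup>2 * (((i - c)\<^sup>2 - 4 * i) * (i * (i - 4)))"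
      by (simp add: power2_eq_square algebra_simps)
    finally show "F (s ^ (p - 2)) = \<chi> ((1 - 4 * s) * ((1 - c * s)\<^sup>2 - 4 * s))"
      unfolding F_def i_def[symmetric] by (metis chi_cong chi_square_mult[OF s2])
  qed simp
  also have "F 0 = 0" by (simp add: F_def chi_eq_0_iff)
  \<comment> \<open>The sum over \<open>U\<close> lacks the term of \<open>\<Phi> c\<close> at
    \<open>s = 0\<close>, which is \<open>\<chi> 1 = 1\<close>.\<close>
  also have "0 + (\<Sum>s\<in>U. \<chi> ((1 - 4 * s) * ((1 - c * s)\<^sup>2 - 4 * s))) = \<Phi> c - 1"
    unfolding \<Phi>_def by (simp only: sum_R) (simp add: chi_1)
  finally have T: "(\<Sum>w\<in>R. G w * \<chi> (w\<^sup>2 - 4 * 1)) = \<Phi> c - 1" .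
  have "(\<Sum>x\<in>R. \<chi> (?D x)) = 1 + (\<Sum>x\<in>U. G (x + 1 * x ^ (p - 2)))"
    by (simp only: sum_R DG cong: sum.cong) (simp add: chi_1)
  also have "\<dots> = 1 + (\<Sum>w\<in>R. G w * (1 + \<chi> (w\<^sup>2 - 4 * 1)))"
    by (simp only: sum_plus_inverse[OF perG one])
  also have "\<dots> = 1 + (\<Sum>w\<in>R. G w) + (\<Sum>w\<in>R. G w * \<chi> (w\<^sup>2 - 4 * 1))"
    by (simp only: distrib_left sum.distrib mult_1_right add.assoc)
  finally show ?thesis by (simp only: sumG T)
qed

text \<open>At \<open>c = - 4\<close> the quadratic factor is 1 + 4s + 16s^2, so the cubic collapses
  to 1 - 64s^3.\<close>

lemma Phi_minus_4: "\<Phi> (- 4) = \<phi> 1"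
proof -
  have 4: "\<not> - 4 \<simeq> 0"
    using two_not_0 cong_mult_0_iff[of 2 2] by (simp add: cong_0_iff)
  have per: "periodic (\<lambda>x. \<chi> (x ^ 3 + 1))"
    by (intro periodicI chi_cong cong_intros)
  have eq: "(1 - 4 * s) * ((1 - (- 4) * s)\<^sup>2 - 4 * s) = (- 4 * s) ^ 3 + 1" for s :: int
    by (simp add: power2_eq_square power3_eq_cube algebra_simps)
  show ?thesis
    unfolding \<Phi>_def \<phi>_def by (simp only: eq reindex_mult[OF per 4])
qed

text \<open>The cubic \<open>r\<^sup>3 + 6 r\<^sup>2 - 3 r\<close> belongs to an elliptic curve that is 2-isogenous to
  \<open>y\<^sup>2 = x\<^sup>3 + 1\<close>; the substitution \<open>w = r - 3 / r\<close> realises the isogeny.\<close>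

lemma Phi_2:
  assumes "p > 3"
  shows "\<Phi> 2 = \<phi> 1"
proof -
  have 4: "\<not> - 4 \<simeq> 0" and four: "\<not> 4 \<simeq> 0" and 8: "\<not> 8 \<simeq> 0"
    using two_not_0 cong_mult_0_iff[of 2 2] cong_mult_0_iff[of 2 4] by (simp_all add: cong_0_iff)
  have 3: "\<not> - 3 \<simeq> 0" using assms by (simp add: cong_0_iff zdvd_not_zless)
  have one: "\<not> 1 \<simeq> 0" using p_gt_2 by (simp add: cong_def)
  define E where "E r = \<chi> (r * (r\<^sup>2 + 6 * r - 3))" for r
  define F where "F w = \<chi> ((w + 6) * (w\<^sup>2 + 12))" for w
  have perE: "periodic E" unfolding E_def
    by (intro periodicI chi_cong cong_intros)
  have perF: "periodic F" unfolding F_def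
    by (intro periodicI chi_cong cong_intros)
  have perG: "periodic (\<lambda>w. \<chi> (w + 6))"
    by (intro periodicI chi_cong cong_intros)
  have perX: "periodic \<chi>"
    by (intro periodicI chi_cong cong_intros)
  \<comment> \<open>The substitution r = 1 - 4s moves the root of the linear factor to 0, at the
    cost of the square factor 4.\<close>
  have "\<chi> ((1 - 4 * s) * ((1 - 2 * s)\<^sup>2 - 4 * s)) = E (- 4 * s + 1)" for s
  proof -
    have "(- 4 * s + 1) * ((- 4 * s + 1)\<^sup>2 + 6 * (- 4 * s + 1) - 3)
        = 2\<^sup>2 * ((1 - 4 * s) * ((1 - 2 * s)\<^sup>2 - 4 * s))"
      by (simp add: power2_eq_square algebra_simps)
    then show ?thesis unfolding E_def by (simp only: chi_square_mult[OF two_not_0])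
  qed
  then have "\<Phi> 2 = (\<Sum>r\<in>R. E r)"
    unfolding \<Phi>_def by (simp only: reindex_affine[OF perE 4])
  also have "\<dots> = (\<Sum>r\<in>U. E r)"
    by (simp only: sum_R) (simp add: E_def chi_eq_0_iff)
  also have "\<dots> = (\<Sum>r\<in>U. \<chi> (r + - 3 * r ^ (p - 2) + 6))"
  proof (rule sum.cong)
    fix r assume "r \<in> U"
    then have r: "\<not> r \<simeq> 0" by (rule U_not_0)
    define i where "i = r ^ (p - 2)"
    have t: "1 \<simeq> r * i" unfolding i_def using mult_inverse_cong_1[OF r] by (rule cong_sym)
    have "r * (r\<^sup>2 + 6 * r - 3) = r * (r\<^sup>2 + 6 * r - 3 * 1)" by simp
    also have "\<dots> \<simeq> r * (r\<^sup>2 + 6 * r - 3 * (r * i))"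
      (is "_ \<simeq> ?B")
      by (intro cong_intros t)
    also have "?B = r\<^sup>2 * (r + - 3 * i + 6)"
      by (simp add: power2_eq_square algebra_simps)
    finally show "E r = \<chi> (r + - 3 * r ^ (p - 2) + 6)"
      unfolding E_def i_def[symmetric] by (metis chi_cong chi_square_mult[OF r])
  qed simp
  also have "\<dots> = (\<Sum>w\<in>R. \<chi> (w + 6) * (1 + \<chi> (w\<^sup>2 - 4 * - 3)))"
    by (rule sum_plus_inverse[OF perG 3])
  also have "\<dots> = (\<Sum>w\<in>R. \<chi> (1 * w + 6)) + (\<Sum>w\<in>R. F w)"
    unfolding F_def chi_mult by (simp add: distrib_left sum.distrib)
  \<comment> \<open>Of the two parts given by \<open>sum_plus_inverse\<close>, the linear one
    vanishes.\<close>
  also have "(\<Sum>w\<in>R. \<chi> (1 * w + 6)) = 0"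
    by (simp only: reindex_affine[OF perX one] sum_chi)
  \<comment> \<open>For w = 4x - 2 the factors of \<open>F\<close> are 4(x + 1) and 16(x^2 - x + 1),
    with product 64(x^3 + 1).\<close>
  also have "0 + (\<Sum>w\<in>R. F w) = (\<Sum>x\<in>R. F (4 * x + - 2))"
    by (simp only: reindex_affine[OF perF four])
  also have "\<dots> = \<phi> 1"
    unfolding \<phi>_def
  proof (rule sum.cong)
    fix x :: int
    have "(4 * x + - 2 + 6) * ((4 * x + - 2)\<^sup>2 + 12) = 8\<^sup>2 * (x ^ 3 + 1)"
      by (simp add: power2_eq_square power3_eq_cube algebra_simps)
    then show "F (4 * x + - 2) = \<chi> (x ^ 3 + 1)"
      unfolding F_def by (simp only: chi_square_mult[OF 8])
  qed simp
  finally show ?thesis .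
qed

lemma phi_1_eq_0:
  assumes "[p = 2] (mod 3)"
  shows "\<phi> 1 = 0"
proof -
  define q where "q = p div 3"
  have p: "p = 3 * q + 2" unfolding q_def using assms by (simp add: cong_def) presburger
  \<comment> \<open>Since \<open>3 * (2 * q + 1) = 2 * (p - 1) + 1\<close>, this exponent inverts
    cubing modulo \<open>p\<close>.\<close>
  have root: "(x ^ 3) ^ (2 * q + 1) \<simeq> x" for x
  proof -
    have "(x ^ 3) ^ (2 * q + 1) = x * (x ^ (p - 1))\<^sup>2"
      unfolding p by (simp flip: power_mult power_Suc) (simp add: algebra_simps power_add power3_eq_cube)
    moreover have "x * (x ^ (p - 1))\<^sup>2 \<simeq> x"
    proof (cases "x \<simeq> 0")
      case True
      then have "x * (x ^ (p - 1))\<^sup>2 \<simeq> 0" by (simp only: cong_mult_0_iff) simp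
      then show ?thesis using True by (simp add: cong_def)
    next
      case False
      then have "x * (x ^ (p - 1))\<^sup>2 \<simeq> x * 1\<^sup>2" by (intro cong_intros fermat_little)
      then show ?thesis by simp
    qed
    ultimately show ?thesis by (simp only:)
  qed
  have inj: "x \<simeq> y" if "x ^ 3 \<simeq> y ^ 3" for x y
    using cong_pow[OF that, of "2 * q + 1"] root[of x] root[of y] by (simp only: cong_def)
  have per: "periodic (\<lambda>x. \<chi> (x + 1))" and perX: "periodic \<chi>"
    by (intro periodicI chi_cong cong_intros; assumption)+
  have one: "\<not> 1 \<simeq> 0" using p_gt_2 by (simp add: cong_def)
  have "\<phi> 1 = (\<Sum>x\<in>R. \<chi> (1 * x + 1))"
    unfolding \<phi>_def by (simp only: reindex[OF per inj] mult_1)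
  then show ?thesis by (simp only: reindex_affine[OF perX one] sum_chi)
qed

end


section \<open>Primitive roots and sums over cubes\<close>

lemma sum_lessThan_mult_period:
  fixes H :: "nat \<Rightarrow> int"
  assumes "\<And>k. H (k + n) = H k"
  shows "(\<Sum>k<m * n. H k) = int m * (\<Sum>k<n. H k)"
proof -
  have per: "H (i + j * n) = H i" for i j
    by (induction j) (simp_all add: assms flip: add.assoc add: add.commute[of n])
  have "(\<Sum>k<m * n. H k) = (\<Sum>j<m. \<Sum>k=j * n..<j * n + n. H k)"
    by (rule sum.nat_group[symmetric])
  also have "\<dots> = (\<Sum>j<m. \<Sum>k<n. H k)"
  proof (rule sum.cong)
    fix j
    have "(\<Sum>k=0 + j * n..<n + j * n. H k) = (\<Sum>k=0..<n. H (k + j * n))"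
      by (rule sum.shift_bounds_nat_ivl)
    then show "(\<Sum>k=j * n..<j * n + n. H k) = (\<Sum>k<n. H k)"
      by (simp only: per atLeast0LessThan add_0 add.commute[of n])
  qed simp
  finally show ?thesis by simp
qed

context odd_prime
begin

lemma periodic_of_bool:
  assumes "\<And>x y. x \<simeq> y \<Longrightarrow> f x \<simeq> f y"
  shows "periodic (\<lambda>x. of_bool (c \<simeq> f x))"
proof (rule periodicI)
  fix x y assume "x \<simeq> y"
  then have "f x \<simeq> f y" by (rule assms)
  then have "c \<simeq> f x \<longleftrightarrow> c \<simeq> f y" by (blast intro: cong_trans cong_sym)
  then show "of_bool (c \<simeq> f x) = (of_bool (c \<simeq> f y) :: int)" by simp
qed

definition primitive :: "int \<Rightarrow> bool" where
  "primitive g \<longleftrightarrow> (\<forall>k. g ^ k \<simeq> 1 \<longleftrightarrow> p - 1 dvd k)"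

lemma primitive_root_exists: obtains g where "primitive g"
proof -
  obtain h where h: "residue_primroot p h"
    using prime_primitive_root_exists[OF prime_p[THEN prime_gt_1_nat]] prime_p by blast
  have ord: "ord p h = p - 1"
    using h prime_p by (simp add: residue_primroot_def totient_prime)
  have "int h ^ k \<simeq> 1 \<longleftrightarrow> p - 1 dvd k" for k
    using cong_int_iff[of "h ^ k" 1 p] ord_divides[of h k p] ord by simp
  then show thesis using that[of "int h"] by (simp add: primitive_def)
qed

lemma primitive_not_0:
  assumes "primitive g"
  shows "\<not> g \<simeq> 0"
proof
  assume "g \<simeq> 0"
  then have "g ^ (p - 1) \<simeq> 0" using p_gt_2 by (simp add: cong_power_0_iff)
  moreover have "g ^ (p - 1) \<simeq> 1" using assms by (simp add: primitive_def)
  ultimately show False using p_gt_2 by (simp add: cong_def)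
qed

lemma primitive_power_not_0:
  assumes "primitive g"
  shows "\<not> g ^ k \<simeq> 0"
  using primitive_not_0[OF assms] prime_int_p prime_dvd_power[of "int p" g k]
  by (auto simp: cong_0_iff)

lemma primitive_power_inj:
  assumes g: "primitive g" and "i < p - 1" "j < p - 1" "g ^ i \<simeq> g ^ j"
  shows "i = j"
  using assms(2-)
proof (induction i j rule: linorder_wlog)
  case (le i j)
  have "g ^ i * g ^ (j - i) \<simeq> g ^ i * 1"
    using le by (simp add: cong_sym_eq flip: power_add)
  moreover have "\<not> g ^ i \<simeq> 0" using g by (rule primitive_power_not_0)
  ultimately have "g ^ (j - i) \<simeq> 1" by (blast intro: cong_mult_cancel)
  then have "p - 1 dvd j - i" using g by (simp add: primitive_def)
  then show ?case using le by (auto dest: dvd_imp_le)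
next
  case (sym i j)
  then show ?case by (simp add: cong_sym_eq)
qed

lemma sum_primitive:
  assumes g: "primitive g" and F: "periodic F"
  shows "(\<Sum>x\<in>U. F x) = (\<Sum>k<p - 1. F (g ^ k))"
proof -
  have inj: "inj_on (\<lambda>k. g ^ k mod int p) {..<p - 1}"
  proof (rule inj_onI)
    fix i j assume "i \<in> {..<p - 1}" "j \<in> {..<p - 1}" "g ^ i mod int p = g ^ j mod int p"
    then show "i = j" by (intro primitive_power_inj[OF g]) (simp_all add: cong_def)
  qed
  have "g ^ k mod int p \<in> U" for k
  proof -
    have "\<not> g ^ k \<simeq> 0" using g by (rule primitive_power_not_0)
    then have "g ^ k mod int p \<noteq> 0" by (simp add: cong_def)
    moreover have "g ^ k mod int p \<ge> 0" "g ^ k mod int p < int p" using p_gt_2 by simp_all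
    ultimately show ?thesis by simp
  qed
  \<comment> \<open>The \<open>p - 1\<close> distinct powers exhaust the \<open>p - 1\<close>
    elements of \<open>U\<close>.\<close>
  then have im: "(\<lambda>k. g ^ k mod int p) ` {..<p - 1} = U"
    using inj p_gt_2 by (intro card_subset_eq) (auto simp: card_image)
  have "(\<Sum>k<p - 1. F (g ^ k)) = (\<Sum>k<p - 1. F (g ^ k mod int p))"
    by (intro sum.cong periodicD[OF F]) auto
  also have "\<dots> = (\<Sum>x\<in>U. F x)"
    by (simp only: im[symmetric] sum.reindex[OF inj] o_def)
  finally show ?thesis ..
qed

text \<open>Cubing wraps the cycle of the \<open>3 * q\<close> powers of \<open>g\<close> three
  times around the \<open>q\<close> nonzero cubes.\<close>

lemma sum_cubes:
  assumes p: "p - 1 = 3 * q" and g: "primitive g" and F: "periodic F"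
  shows "(\<Sum>x\<in>U. F (x ^ 3)) = 3 * (\<Sum>k<q. F (g ^ (3 * k)))"
proof -
  have "periodic (\<lambda>x. F (x ^ 3))"
    by (intro periodicI periodicD[OF F] cong_pow)
  then have "(\<Sum>x\<in>U. F (x ^ 3)) = (\<Sum>k<3 * q. F ((g ^ k) ^ 3))"
    using sum_primitive[OF g] p by simp
  also have "\<dots> = (\<Sum>k<3 * q. F (g ^ (3 * k)))"
    by (simp flip: power_mult add: mult.commute)
  also have "\<dots> = int 3 * (\<Sum>k<q. F (g ^ (3 * k)))"
  proof (rule sum_lessThan_mult_period)
    fix k
    have "g ^ (3 * (k + q)) = g ^ (3 * k) * g ^ (p - 1)"
      unfolding p by (simp add: algebra_simps flip: power_add)
    moreover have "g ^ (3 * k) * g ^ (p - 1) \<simeq> g ^ (3 * k) * 1"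
      using g by (intro cong_mult) (auto simp: primitive_def)
    ultimately show "F (g ^ (3 * (k + q))) = F (g ^ (3 * k))"
      by (intro periodicD[OF F]) simp
  qed
  finally show ?thesis by simp
qed

section \<open>Moments of \<open>\<psi>\<close> and the representation of \<open>p\<close> as l^2 +
  3v^2\<close>

definition \<psi> :: "int \<Rightarrow> int" where "\<psi> a = \<chi> a * \<phi> a"

lemma phi_periodic: "periodic \<phi>"
  unfolding \<phi>_def by (intro periodicI sum.cong refl chi_cong cong_intros)

lemma psi_periodic: "periodic \<psi>"
  using periodicD[OF phi_periodic] chi_cong
  unfolding \<psi>_def periodic_def by metis

text \<open>Scaling \<open>x\<close> by \<open>b\<close> shows that
  \<open>\<phi> (a * b ^ 3)\<close> is \<open>\<chi> b * \<phi> a\<close>. The factor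
  \<open>\<chi> a\<close> in \<open>\<psi>\<close> is there to absorb this sign.\<close>

lemma psi_mult_cube:
  assumes b: "\<not> b \<simeq> 0"
  shows "\<psi> (a * b ^ 3) = \<psi> a"
proof -
  have per: "periodic (\<lambda>x. \<chi> (x ^ 3 + a * b ^ 3))"
    by (intro periodicI chi_cong cong_intros)
  have eq: "(b * x) ^ 3 + a * b ^ 3 = b ^ 3 * (x ^ 3 + a)" for x
    by (simp add: power_mult_distrib algebra_simps)
  have "\<phi> (a * b ^ 3) = (\<Sum>x\<in>R. \<chi> ((b * x) ^ 3 + a * b ^ 3))"
    unfolding \<phi>_def by (rule reindex_mult[OF per b, symmetric])
  also have "\<dots> = \<chi> b * \<phi> a"
    unfolding \<phi>_def by (simp only: eq chi_mult chi_cube sum_distrib_left)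
  finally have "\<psi> (a * b ^ 3) = (\<chi> b * \<chi> b) * (\<chi> a * \<phi> a)"
    by (simp add: \<psi>_def chi_mult chi_cube)
  then show ?thesis using b by (simp add: chi_sq \<psi>_def)
qed

text \<open>After exchanging sums, the argument of \<open>\<chi>\<close> is quadratic in
  \<open>a\<close> with discriminant x^6. The inner sum is -1, or \<open>p - 1\<close> at
  \<open>x = 0\<close>, and the total cancels.\<close>

lemma sum_psi: "(\<Sum>a\<in>R. \<psi> a) = 0"
proof -
  have "\<psi> a = (\<Sum>x\<in>R. \<chi> (a\<^sup>2 + x ^ 3 * a + 0))" for a
  proof -
    have "a * (x ^ 3 + a) = a\<^sup>2 + x ^ 3 * a + 0" for x
      by (simp add: power2_eq_square algebra_simps)
    then show ?thesis
      unfolding \<psi>_def \<phi>_def by (simp only: sum_distrib_left chi_mult[symmetric])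
  qed
  then have "(\<Sum>a\<in>R. \<psi> a) = (\<Sum>x\<in>R. \<Sum>a\<in>R. \<chi> (a\<^sup>2 + x ^ 3 * a + 0))"
    by (simp only:) (rule sum.swap)
  also have "\<dots> = (\<Sum>x\<in>R. int p * of_bool (0 \<simeq> x) - 1)"
  proof (rule sum.cong)
    fix x
    have "(x ^ 3)\<^sup>2 - 4 * 0 \<simeq> 0 \<longleftrightarrow> 0 \<simeq> x"
      using cong_power_0_iff[of 6 x] by (simp add: cong_sym_eq flip: power_mult)
    then show "(\<Sum>a\<in>R. \<chi> (a\<^sup>2 + x ^ 3 * a + 0)) = int p * of_bool (0 \<simeq> x) - 1"
      by (simp only: sum_chi_quadratic_general)
  qed simp
  also have "\<dots> = int p * (\<Sum>x\<in>R. of_bool (0 \<simeq> x) * 1) - int p"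
    by (simp only: sum_subtractf sum_distrib_left mult_1_right) simp
  also have "\<dots> = 0" by (simp only: sum_indicator)
  finally show ?thesis .
qed

text \<open>Expanding the square gives, for each pair \<open>x\<close>, \<open>y\<close>, a
  quadratic in \<open>a\<close> with discriminant (x^3 - y^3)^2, so pairs with equal cubes
  contribute an extra \<open>p\<close>.\<close>

lemma sum_phi_square:
  "(\<Sum>a\<in>R. (\<phi> a)\<^sup>2) = int p * (\<Sum>x\<in>R. \<Sum>y\<in>R. of_bool (x ^ 3 \<simeq> y ^ 3)) - (int p)\<^sup>2"
proof -
  let ?f = "\<lambda>x y a. \<chi> (a\<^sup>2 + (x ^ 3 + y ^ 3) * a + x ^ 3 * y ^ 3)"
  have "(\<phi> a)\<^sup>2 = (\<Sum>x\<in>R. \<Sum>y\<in>R. ?f x y a)" for a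
  proof -
    have "(x ^ 3 + a) * (y ^ 3 + a) = a\<^sup>2 + (x ^ 3 + y ^ 3) * a + x ^ 3 * y ^ 3" for x y
      by (simp add: power2_eq_square algebra_simps)
    then have "?f x y a = \<chi> (x ^ 3 + a) * \<chi> (y ^ 3 + a)" for x y
      by (metis chi_mult)
    moreover have "(\<phi> a)\<^sup>2 = (\<Sum>x\<in>R. \<Sum>y\<in>R. \<chi> (x ^ 3 + a) * \<chi> (y ^ 3 + a))"
      unfolding \<phi>_def by (subst power2_eq_square) (rule sum_product)
    ultimately show ?thesis by (simp only:)
  qed
  then have "(\<Sum>a\<in>R. (\<phi> a)\<^sup>2) = (\<Sum>a\<in>R. \<Sum>x\<in>R. \<Sum>y\<in>R. ?f x y a)"
    by (simp only:)
  also have "\<dots> = (\<Sum>x\<in>R. \<Sum>y\<in>R. \<Sum>a\<in>R. ?f x y a)"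
    by (subst sum.swap) (intro sum.cong refl sum.swap)
  also have "\<dots> = (\<Sum>x\<in>R. \<Sum>y\<in>R. int p * of_bool (x ^ 3 \<simeq> y ^ 3) - 1)"
  proof (intro sum.cong refl)
    fix x y :: int
    have "(x ^ 3 + y ^ 3)\<^sup>2 - 4 * (x ^ 3 * y ^ 3) = (x ^ 3 - y ^ 3)\<^sup>2"
      by (simp add: power2_eq_square algebra_simps)
    moreover have "(x ^ 3 - y ^ 3)\<^sup>2 \<simeq> 0 \<longleftrightarrow> x ^ 3 \<simeq> y ^ 3"
      by (simp add: cong_power_0_iff) (simp add: cong_iff_dvd_diff)
    ultimately show "(\<Sum>a\<in>R. ?f x y a) = int p * of_bool (x ^ 3 \<simeq> y ^ 3) - 1"
      by (simp only: sum_chi_quadratic_general)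
  qed
  also have "\<dots> = int p * (\<Sum>x\<in>R. \<Sum>y\<in>R. of_bool (x ^ 3 \<simeq> y ^ 3)) - (int p)\<^sup>2"
    by (simp only: sum_subtractf sum_distrib_left) (simp add: power2_eq_square)
  finally show ?thesis .
qed

lemma phi_0: "\<phi> 0 = 0"
  by (simp add: \<phi>_def chi_cube sum_chi)

text \<open>Zero pairs only with itself, and each unit with its three multiples by cube roots of
  unity: 1 + 3(p - 1) pairs.\<close>

lemma count_equal_cubes:
  assumes p: "p - 1 = 3 * q"
  shows "(\<Sum>x\<in>R. \<Sum>y\<in>R. of_bool (x ^ 3 \<simeq> y ^ 3)) = 3 * int p - 2"
proof -
  obtain g where g: "primitive g" by (rule primitive_root_exists)
  have q: "q > 0" using p p_gt_2 by (cases q) auto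
  have per1: "periodic (\<lambda>z. of_bool (1 \<simeq> z))"
    by (intro periodic_of_bool)
  have "(\<Sum>y\<in>U. of_bool (1 \<simeq> y ^ 3)) = 3 * (\<Sum>k<q. of_bool (1 \<simeq> g ^ (3 * k)) :: int)"
    by (rule sum_cubes[OF p g per1])
  \<comment> \<open>For \<open>k < q\<close>, the exponent \<open>3 * k\<close> is a multiple of
    \<open>p - 1 = 3 * q\<close> only at \<open>k = 0\<close>.\<close>
  also have "(\<Sum>k<q. of_bool (1 \<simeq> g ^ (3 * k)) :: int) = (\<Sum>k\<in>{0::nat}. 1)"
  proof (rule sum.mono_neutral_cong_right)
    show "\<forall>k\<in>{..<q} - {0}. of_bool (1 \<simeq> g ^ (3 * k)) = (0 :: int)"
      using g unfolding primitive_def p by (auto simp: cong_sym_eq[of 1] dest: dvd_imp_le)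
  qed (use q in auto)
  finally have three: "(\<Sum>y\<in>U. of_bool (1 \<simeq> y ^ 3)) = (3 :: int)" by simp
  have nonzero: "(\<Sum>y\<in>R. of_bool (x ^ 3 \<simeq> y ^ 3)) = (3 :: int)" if "x \<in> U" for x
  proof -
    have x: "\<not> x \<simeq> 0" using that by (rule U_not_0)
    have x3: "\<not> x ^ 3 \<simeq> 0" using x by (simp add: cong_power_0_iff)
    have per: "periodic (\<lambda>y. of_bool (x ^ 3 \<simeq> y ^ 3))"
      by (intro periodic_of_bool cong_pow)
    have iff: "x ^ 3 \<simeq> (x * y) ^ 3 \<longleftrightarrow> 1 \<simeq> y ^ 3" for y
    proof
      assume "x ^ 3 \<simeq> (x * y) ^ 3"
      then have "x ^ 3 * 1 \<simeq> x ^ 3 * y ^ 3" by (simp only: power_mult_distrib mult_1_right)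
      with x3 show "1 \<simeq> y ^ 3" by (rule cong_mult_cancel)
    next
      assume "1 \<simeq> y ^ 3"
      then have "x ^ 3 * 1 \<simeq> x ^ 3 * y ^ 3" by (rule cong_scalar_left)
      then show "x ^ 3 \<simeq> (x * y) ^ 3" by (simp only: power_mult_distrib mult_1_right)
    qed
    have "(\<Sum>y\<in>R. of_bool (x ^ 3 \<simeq> y ^ 3)) = (\<Sum>y\<in>R. of_bool (1 \<simeq> y ^ 3) :: int)"
      using reindex_mult[OF per x] by (simp only: iff)
    also have "\<dots> = 3"
      using three p_gt_2 by (simp only: sum_R) (simp add: cong_def)
    finally show ?thesis .
  qed
  have zero: "(\<Sum>y\<in>R. of_bool (0 ^ 3 \<simeq> y ^ 3)) = (1 :: int)"
  proof -
    have "0 ^ 3 \<simeq> y ^ 3 \<longleftrightarrow> 0 \<simeq> y" for y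
      using cong_power_0_iff[of 3 y] by (simp add: cong_sym_eq)
    then show ?thesis using sum_indicator[of 0 "\<lambda>_. 1"] by simp
  qed
  have "(\<Sum>x\<in>R. \<Sum>y\<in>R. of_bool (x ^ 3 \<simeq> y ^ 3))
      = (\<Sum>y\<in>R. of_bool (0 ^ 3 \<simeq> y ^ 3)) + (\<Sum>x\<in>U. \<Sum>y\<in>R. of_bool (x ^ 3 \<simeq> y ^ 3) :: int)"
    by (rule sum_R)
  also have "\<dots> = 1 + (\<Sum>x\<in>U. 3)"
    using nonzero zero by (intro arg_cong2[of _ _ _ _ "(+)"] sum.cong) auto
  finally show ?thesis using p_gt_2 by (simp add: of_nat_diff)
qed

text \<open>A value of \<open>\<chi>\<close> is odd except at 0, so \<open>\<phi> 1\<close> has the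
  parity of \<open>p\<close> minus the number of roots of x^3 + 1. That number is 1 or 3, and
  \<open>p\<close> is odd.\<close>

lemma phi_1_even:
  assumes "p > 3"
  shows "even (\<phi> 1)"
proof -
  have one: "\<not> 1 \<simeq> 0" using p_gt_2 by (simp add: cong_def)
  have 3: "\<not> - 3 \<simeq> 0" using assms by (simp add: cong_0_iff zdvd_not_zless)
  have roots: "of_bool (x ^ 3 + 1 \<simeq> 0) =
      of_bool (- 1 \<simeq> x) * 1 + (of_bool (1 * x\<^sup>2 + (- 1) * x + 1 \<simeq> 0) :: int)" for x
  proof -
    have "x ^ 3 + 1 = (x - (- 1)) * (1 * x\<^sup>2 + (- 1) * x + 1)"
      by (simp add: power2_eq_square power3_eq_cube algebra_simps)
    then have "x ^ 3 + 1 \<simeq> 0 \<longleftrightarrow> x \<simeq> - 1 \<or> 1 * x\<^sup>2 + (- 1) * x + 1 \<simeq> 0"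
      by (simp only: cong_mult_0_iff) (simp add: cong_iff_dvd_diff)
    \<comment> \<open>At -1 the quadratic factor takes the value 3, which is nonzero as
      \<open>p > 3\<close>; the two kinds of roots are therefore disjoint.\<close>
    moreover have "\<not> 1 * x\<^sup>2 + (- 1) * x + 1 \<simeq> 0" if "x \<simeq> - 1"
    proof -
      have "1 * x\<^sup>2 + (- 1) * x + 1 \<simeq> 1 * (- 1)\<^sup>2 + (- 1) * (- 1) + 1"
        by (intro cong_intros that)
      then show ?thesis using 3 cong_minus_minus_iff[of 3 0 "int p"] by (simp add: cong_def)
    qed
    ultimately show ?thesis by (auto simp: cong_sym_eq)
  qed
  have "(\<Sum>x\<in>R. of_bool (x ^ 3 + 1 \<simeq> 0)) = 1 + (1 + \<chi> ((- 1)\<^sup>2 - 4 * 1 * 1))"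
    by (simp only: roots sum.distrib sum_indicator count_quadratic[OF one])
  moreover have "odd (\<chi> ((- 1)\<^sup>2 - 4 * 1 * 1))"
    using chi_range[of "- 3"] chi_eq_0_iff[of "- 3"] 3 by auto
  ultimately have odd: "odd (\<Sum>x\<in>R. of_bool (x ^ 3 + 1 \<simeq> 0) :: int)" by simp
  have "even (\<Sum>x\<in>R. \<chi> (x ^ 3 + 1) + of_bool (x ^ 3 + 1 \<simeq> 0) + 1)"
  proof (rule dvd_sum)
    fix x :: int
    show "even (\<chi> (x ^ 3 + 1) + of_bool (x ^ 3 + 1 \<simeq> 0) + 1)"
      using chi_range[of "x ^ 3 + 1"] chi_eq_0_iff[of "x ^ 3 + 1"] by auto
  qed
  moreover have "odd p" using prime_p p_gt_2 prime_odd_nat by blast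
  ultimately show ?thesis using odd unfolding \<phi>_def by (simp add: sum.distrib)
qed

lemma phi_1_representation:
  assumes "p > 3" "3 dvd p - 1"
  obtains l v where "\<phi> 1 = 2 * l" "int p = l\<^sup>2 + 3 * v\<^sup>2" "[l = - 1] (mod 3)"
proof -
  obtain q where p: "p - 1 = 3 * q" using assms by blast
  have pq: "int p = 3 * int q + 1" using p p_gt_2 by linarith
  have q: "q > 0" using p p_gt_2 by (cases q) auto
  obtain g where g: "primitive g" by (rule primitive_root_exists)
  \<comment> \<open>\<open>\<psi> (g ^ k)\<close> depends only on \<open>k\<close> modulo 3, so each
    of the three values occurs \<open>q\<close> times.\<close>
  have classes: "(\<Sum>a\<in>U. H (\<psi> a)) = int q * (H (\<psi> 1) + H (\<psi> g) + H (\<psi> (g\<^sup>2)))" for H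
  proof -
    have per: "periodic (\<lambda>a. H (\<psi> a))"
      by (intro periodicI arg_cong[of _ _ H] periodicD[OF psi_periodic])
    have "(\<Sum>a\<in>U. H (\<psi> a)) = (\<Sum>k<q * 3. H (\<psi> (g ^ k)))"
      using sum_primitive[OF g per] p by (simp add: mult.commute)
    also have "\<dots> = int q * (\<Sum>k<3. H (\<psi> (g ^ k)))"
      using psi_mult_cube[OF primitive_not_0[OF g]] by (intro sum_lessThan_mult_period) (simp add: power_add)
    finally show ?thesis by (simp add: eval_nat_numeral algebra_simps)
  qed
  define L M N where "L = \<psi> 1" and "M = \<psi> g" and "N = \<psi> (g\<^sup>2)"
  have L: "L = \<phi> 1" by (simp add: L_def \<psi>_def chi_1)
  have psi0: "\<psi> 0 = 0" by (simp add: \<psi>_def phi_0)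
  have "int q * (L + M + N) = 0"
    using sum_psi classes[of "\<lambda>x. x"] by (simp add: sum_R psi0 L_def M_def N_def)
  then have N: "N = - (L + M)" using q by simp
  have "int q * (L\<^sup>2 + M\<^sup>2 + N\<^sup>2) = (\<Sum>a\<in>U. (\<psi> a)\<^sup>2)"
    using classes[of "\<lambda>x. x\<^sup>2"] by (simp add: L_def M_def N_def)
  also have "\<dots> = (\<Sum>a\<in>U. (\<phi> a)\<^sup>2)"
    by (intro sum.cong refl) (use chi_square U_not_0 in \<open>simp add: \<psi>_def power_mult_distrib chi_sq[folded power2_eq_square]\<close>)
  also have "\<dots> = (\<Sum>a\<in>R. (\<phi> a)\<^sup>2)" by (simp add: sum_R phi_0)
  also have "\<dots> = int p * (3 * int p - 2) - (int p)\<^sup>2"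
    by (simp only: sum_phi_square count_equal_cubes[OF p])
  also have "\<dots> = int q * (6 * int p)"
    by (simp add: pq power2_eq_square algebra_simps)
  finally have "L\<^sup>2 + M\<^sup>2 + N\<^sup>2 = 6 * int p" using q by simp
  then have LM: "L\<^sup>2 + L * M + M\<^sup>2 = 3 * int p"
    by (simp add: N power2_eq_square algebra_simps)
  obtain l where l: "L = 2 * l"
    using phi_1_even[OF assms(1)] L by blast
  \<comment> \<open>Completing the square in L^2 + LM + M^2 = 3p with L = 2l; the factor 3 then
    forces \<open>M + l\<close> to be a multiple of 3.\<close>
  have "(M + l)\<^sup>2 = 3 * (int p - l\<^sup>2)"
    using LM by (simp add: l power2_eq_square algebra_simps)
  then have "3 dvd (M + l)\<^sup>2" by simp
  then have "3 dvd M + l" by (rule prime_dvd_power[rotated]) simp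
  then obtain v where v: "M + l = 3 * v" by blast
  have "int p = l\<^sup>2 + 3 * v\<^sup>2"
    using \<open>(M + l)\<^sup>2 = 3 * (int p - l\<^sup>2)\<close> by (simp add: v power2_eq_square algebra_simps)
  moreover have "[l = - 1] (mod 3)"
  proof -
    have per: "periodic (\<lambda>x. \<chi> (x + 1))"
      by (intro periodicI chi_cong cong_intros)
    \<comment> \<open>The term \<open>x = 0\<close> gives 1 and the units come in triples with equal
      cubes. This fixes \<open>l\<close> modulo 3 and hence its sign.\<close>
    have "\<phi> 1 = 1 + 3 * (\<Sum>k<q. \<chi> (g ^ (3 * k) + 1))"
      unfolding \<phi>_def by (simp only: sum_R sum_cubes[OF p g per]) (simp add: chi_1)
    then have "2 * l = 1 + 3 * (\<Sum>k<q. \<chi> (g ^ (3 * k) + 1))" using l L by simp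
    then show ?thesis unfolding cong_iff_dvd_diff by presburger
  qed
  ultimately show thesis using that l L by simp
qed

end

text \<open>The product of \<open>a * d - c * b\<close> and \<open>- a * d - c * b\<close> is p(b^2
  - d^2), so \<open>p\<close> divides one factor. Up to the sign of \<open>d\<close>, the identity
  p^2 = (ac + 3bd)^2 + 3(ad - cb)^2 then leaves no room unless ad = cb.\<close>

lemma prime_square_plus_3_square_unique:
  fixes a b c d :: int
  assumes p: "prime p" "p = a\<^sup>2 + 3 * b\<^sup>2" "p = c\<^sup>2 + 3 * d\<^sup>2"
  shows "a\<^sup>2 = c\<^sup>2"
proof -
  have *: "a\<^sup>2 = c\<^sup>2" if cd: "p = c\<^sup>2 + 3 * d\<^sup>2" and dv: "p dvd a * d - c * b" for c d
  proof -
    obtain k where k: "a * d - c * b = p * k" using dv by (elim dvdE)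
    have "p\<^sup>2 = (a\<^sup>2 + 3 * b\<^sup>2) * (c\<^sup>2 + 3 * d\<^sup>2)"
      using p(2) cd by (simp add: power2_eq_square)
    also have "\<dots> = (a * c + 3 * b * d)\<^sup>2 + 3 * (a * d - c * b)\<^sup>2"
      by (simp add: power2_eq_square algebra_simps)
    finally have "p\<^sup>2 = (a * c + 3 * b * d)\<^sup>2 + p\<^sup>2 * (3 * k\<^sup>2)"
      by (simp add: k power_mult_distrib)
    then have "p\<^sup>2 * (3 * k\<^sup>2) \<le> p\<^sup>2 * 1"
      using zero_le_power2[of "a * c + 3 * b * d"] by linarith
    moreover have p0: "p > 0" using p(1) by (rule prime_gt_0_int)
    ultimately have "3 * k\<^sup>2 \<le> 1" by (simp only: mult_le_cancel_left_pos zero_less_power)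
    then have "k\<^sup>2 = 0" using zero_le_power2[of k] by linarith
    then have "a * d = c * b" using k by simp
    then have "a\<^sup>2 * d\<^sup>2 = c\<^sup>2 * b\<^sup>2" by (metis power_mult_distrib)
    moreover have "a\<^sup>2 * p = a\<^sup>2 * c\<^sup>2 + 3 * (a\<^sup>2 * d\<^sup>2)" "c\<^sup>2 * p = c\<^sup>2 * a\<^sup>2 + 3 * (c\<^sup>2 * b\<^sup>2)"
      by (subst cd, simp add: algebra_simps) (subst p(2), simp add: algebra_simps)
    ultimately have "a\<^sup>2 * p = c\<^sup>2 * p" by (simp add: algebra_simps)
    then show ?thesis using p0 by simp
  qed
  have "(a * d - c * b) * (a * (- d) - c * b) = c\<^sup>2 * b\<^sup>2 - a\<^sup>2 * d\<^sup>2"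
    by (simp add: power2_eq_square algebra_simps)
  also have "\<dots> = p * (b\<^sup>2 - d\<^sup>2)"
  proof -
    have a: "a\<^sup>2 = p - 3 * b\<^sup>2" and c: "c\<^sup>2 = p - 3 * d\<^sup>2" using p by simp_all
    show ?thesis unfolding a c by (simp add: algebra_simps)
  qed
  finally have "p dvd (a * d - c * b) * (a * (- d) - c * b)" by simp
  then have "p dvd a * d - c * b \<or> p dvd a * (- d) - c * b"
    using p(1) by (simp only: prime_dvd_mult_iff)
  then show ?thesis using *[of c d] *[of c "- d"] p(3) by auto
qed


section \<open>Power sums, constant terms and the points on \<open>P = c\<close>\<close>

lemma sum_rotate:
  "(\<Sum>a\<in>A. \<Sum>b\<in>B. \<Sum>c\<in>C. f a b c) = (\<Sum>b\<in>B. \<Sum>c\<in>C. \<Sum>a\<in>A. f a b c)"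
  by (subst sum.swap) (intro sum.cong refl sum.swap)

context odd_prime
begin

text \<open>If \<open>p - 1\<close> does not divide \<open>e\<close>, replacing \<open>x\<close> by
  \<open>g * x\<close> multiplies the sum by \<open>g ^ e\<close>, which is not 1, so the sum
  vanishes. Otherwise every term is 1.\<close>

lemma sum_powers: "(\<Sum>x\<in>U. x ^ e) \<simeq> - of_bool (p - 1 dvd e)"
proof (cases "p - 1 dvd e")
  case True
  then obtain k where k: "e = (p - 1) * k" by (elim dvdE)
  have "(\<Sum>x\<in>U. x ^ e) \<simeq> (\<Sum>x\<in>U. 1 ^ k)"
    unfolding k power_mult using U_not_0 by (intro cong_sum cong_pow fermat_little)
  moreover have "(\<Sum>x\<in>U. 1 ^ k) \<simeq> - 1"
    using p_gt_2 by (simp add: cong_iff_dvd_diff of_nat_diff)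
  ultimately show ?thesis using True by (simp add: cong_def)
next
  case False
  then have e: "e > 0" by (auto intro: Nat.gr0I)
  obtain g where g: "primitive g" by (rule primitive_root_exists)
  \<comment> \<open>Powers of congruent numbers are congruent but need not be equal; reduction
    modulo \<open>p\<close> gives a function to which \<open>reindex_mult\<close> applies.\<close>
  have per: "periodic (\<lambda>x. x ^ e mod int p)"
    by (auto intro!: periodicI cong_pow simp flip: cong_def)
  have F: "x ^ e mod int p \<simeq> x ^ e" for x by simp
  have "g ^ e * (\<Sum>x\<in>R. x ^ e) = (\<Sum>x\<in>R. (g * x) ^ e)"
    by (simp add: power_mult_distrib sum_distrib_left)
  also have "\<dots> \<simeq> (\<Sum>x\<in>R. (g * x) ^ e mod int p)"
    by (intro cong_sum cong_sym[OF F])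
  also have "(\<Sum>x\<in>R. (g * x) ^ e mod int p) = (\<Sum>x\<in>R. x ^ e mod int p)"
    by (rule reindex_mult[OF per primitive_not_0[OF g]])
  also have "(\<Sum>x\<in>R. x ^ e mod int p) \<simeq> (\<Sum>x\<in>R. x ^ e)"
    by (intro cong_sum F)
  finally have "(g ^ e - 1) * (\<Sum>x\<in>R. x ^ e) \<simeq> 0"
    by (simp add: cong_iff_dvd_diff algebra_simps)
  moreover have "\<not> g ^ e - 1 \<simeq> 0"
    using g False by (simp add: primitive_def cong_iff_dvd_diff)
  ultimately have "(\<Sum>x\<in>R. x ^ e) \<simeq> 0" by (simp only: cong_mult_0_iff) simp
  then show ?thesis using False e by (simp add: sum_R power_0_left)
qed

text \<open>Here \<open>(x y) ^ (p - 2)\<close> is the inverse of \<open>x y\<close> modulo \<open>p\<close>.\<close>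

definition P :: "int \<Rightarrow> int \<Rightarrow> int" where
  "P x y = (1 + x) * (1 + y) * (1 + (x * y) ^ (p - 2))"

text \<open>Modulo \<open>p - 1\<close> the exponent is i - k, of absolute value at most
  \<open>n\<close>. A nonzero multiple of \<open>p - 1\<close> is reached only at the two extremes,
  with \<open>n = p - 1\<close>.\<close>

lemma dvd_exponent_iff:
  assumes "i \<le> n" "k \<le> n" "n \<le> p - 1"
  shows "p - 1 dvd i + (p - 2) * k \<longleftrightarrow> i = k \<or> n = p - 1 \<and> (k = 0 \<and> i = n \<or> k = n \<and> i = 0)"
proof -
  have "p - 1 = (p - 2) + 1" using p_gt_2 by simp
  then have "int (i + (p - 2) * k) = (int i - int k) + int (p - 1) * int k"
    by (simp only: of_nat_add of_nat_mult) (simp add: algebra_simps)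
  then have "p - 1 dvd i + (p - 2) * k \<longleftrightarrow> int (p - 1) dvd int i - int k"
    by (simp only: int_dvd_int_iff[symmetric] dvd_add_left_iff[OF dvd_triv_left])
  also have "\<dots> \<longleftrightarrow> i = k \<or> n = p - 1 \<and> (k = 0 \<and> i = n \<or> k = n \<and> i = 0)"
  proof
    assume dv: "int (p - 1) dvd int i - int k"
    show "i = k \<or> n = p - 1 \<and> (k = 0 \<and> i = n \<or> k = n \<and> i = 0)"
    proof (cases "i = k")
      case False
      then have "\<bar>int (p - 1)\<bar> \<le> \<bar>int i - int k\<bar>" using dv by (intro dvd_imp_le_int) auto
      then show ?thesis using assms by linarith
    qed simp
  qed auto
  finally show ?thesis .
qed

text \<open>Expanding the third factor of \<open>P\<close> separates \<open>x\<close> from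
  \<open>y\<close>, so the \<open>k\<close>-th term is a binomial coefficient times a square
  \<open>A k * A k\<close>. By \<open>sum_powers\<close>, \<open>A k\<close> is minus the same
  coefficient, whence its cube, apart from the corner terms \<open>?e\<close>.\<close>

lemma sum_P_power:
  assumes n: "n \<le> p - 1"
  shows "(\<Sum>x\<in>U. \<Sum>y\<in>U. P x y ^ n) \<simeq> franel n + 6 * of_bool (n = p - 1)"
proof -
  let ?C = "\<lambda>k. int (n choose k)"
  define A where "A k = (\<Sum>x\<in>U. (x + 1) ^ n * x ^ ((p - 2) * k))" for k
  have P: "P x y ^ n = (\<Sum>k\<le>n. ?C k * (((x + 1) ^ n * x ^ ((p - 2) * k)) * ((y + 1) ^ n * y ^ ((p - 2) * k))))" for x y
  proof -
    have "P x y ^ n = (x + 1) ^ n * (y + 1) ^ n * ((x * y) ^ (p - 2) + 1) ^ n"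
      unfolding P_def power_mult_distrib by (simp only: add.commute)
    also have "((x * y) ^ (p - 2) + 1) ^ n = (\<Sum>k\<le>n. ?C k * (x ^ ((p - 2) * k) * y ^ ((p - 2) * k)))"
      by (simp add: binomial_ring power_mult power_mult_distrib)
    finally show ?thesis by (simp add: sum_distrib_left mult_ac)
  qed
  have "(\<Sum>x\<in>U. \<Sum>y\<in>U. P x y ^ n) = (\<Sum>k\<le>n. \<Sum>x\<in>U. \<Sum>y\<in>U.
      ?C k * (((x + 1) ^ n * x ^ ((p - 2) * k)) * ((y + 1) ^ n * y ^ ((p - 2) * k))))"
    unfolding P by (rule sum_rotate[symmetric])
  also have "\<dots> = (\<Sum>k\<le>n. ?C k * (A k * A k))"
    unfolding A_def sum_product by (simp only: sum_distrib_left)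
  finally have sumA: "(\<Sum>x\<in>U. \<Sum>y\<in>U. P x y ^ n) = (\<Sum>k\<le>n. ?C k * (A k * A k))" .
  define b where "b \<longleftrightarrow> n = p - 1"
  let ?e = "\<lambda>k. of_bool (b \<and> k = 0) + of_bool (b \<and> k = n) :: int"
  have n0: "b \<Longrightarrow> n \<noteq> 0" using p_gt_2 by (simp add: b_def)
  have exclusive: "of_bool (i = k \<or> b \<and> (k = 0 \<and> i = n \<or> k = n \<and> i = 0))
      = (of_bool (i = k) + of_bool (b \<and> k = 0 \<and> i = n) + of_bool (b \<and> k = n \<and> i = 0) :: int)"
    for i k
    using n0 by (cases b) auto
  have A: "A k \<simeq> - (?C k + ?e k)" if k: "k \<le> n" for k
  proof -
    have expand: "A k = (\<Sum>i\<le>n. ?C i * (\<Sum>x\<in>U. x ^ (i + (p - 2) * k)))"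
      unfolding A_def binomial_ring sum_distrib_right sum_distrib_left
      by (subst sum.swap) (simp add: power_add mult_ac)
    have reduce: "(\<Sum>i\<le>n. ?C i * (\<Sum>x\<in>U. x ^ (i + (p - 2) * k)))
      \<simeq> (\<Sum>i\<le>n. ?C i * (- of_bool (p - 1 dvd i + (p - 2) * k)))"
      by (intro cong_sum cong_mult cong_refl sum_powers)
    have "(\<Sum>i\<le>n. ?C i * (- of_bool (p - 1 dvd i + (p - 2) * k)))
      = (\<Sum>i\<le>n. - ((if i = k then ?C i else 0) + (if i = n then of_bool (b \<and> k = 0) else 0)
          + (if i = 0 then of_bool (b \<and> k = n) else 0)))"
    proof (rule sum.cong)
      fix i assume "i \<in> {..n}"
      then have "of_bool (p - 1 dvd i + (p - 2) * k) = (of_bool (i = k)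
          + of_bool (b \<and> k = 0 \<and> i = n) + of_bool (b \<and> k = n \<and> i = 0) :: int)"
        using exclusive by (subst dvd_exponent_iff[OF _ k n, folded b_def]) simp_all
      then show "?C i * (- of_bool (p - 1 dvd i + (p - 2) * k))
        = - ((if i = k then ?C i else 0) + (if i = n then of_bool (b \<and> k = 0) else 0)
          + (if i = 0 then of_bool (b \<and> k = n) else 0))"
        by simp
    qed simp
    also have "\<dots> = - (?C k + ?e k)"
      using k by (simp only: sum_negf sum.distrib sum.delta finite_atMost atMost_iff le_refl le0 if_True add.assoc)
    finally show ?thesis using reduce by (simp only: expand)
  qed
  have "(\<Sum>k\<le>n. ?C k * (A k * A k)) \<simeq> (\<Sum>k\<le>n. ?C k * (- (?C k + ?e k) * - (?C k + ?e k)))"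
    by (intro cong_sum cong_mult cong_refl A) auto
  \<comment> \<open>For \<open>n = p - 1\<close>, each of the distinct indices 0 and
    \<open>n\<close> contributes 2^2 = 4 in place of 1, an excess of 3.\<close>
  also have "(\<Sum>k\<le>n. ?C k * (- (?C k + ?e k) * - (?C k + ?e k)))
      = (\<Sum>k\<le>n. ?C k ^ 3 + (if k = 0 then 3 * of_bool b else 0)
          + (if k = n then 3 * of_bool b else 0))"
    using n0 by (intro sum.cong) (auto simp: power3_eq_cube)
  also have "\<dots> = franel n + 6 * of_bool (n = p - 1)"
    unfolding franel_def atLeast0AtMost b_def[symmetric] by (simp add: sum.distrib)
  finally show ?thesis by (simp only: sumA)
qed

lemma sum_P_minus_8_power:
  assumes n: "n \<le> p - 1"
  shows "(\<Sum>x\<in>U. \<Sum>y\<in>U. (P x y - 8) ^ n) \<simeq> Q n + 6 * of_bool (n = p - 1)"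
proof -
  let ?C = "\<lambda>k. int (n choose k) * (- 8) ^ (n - k)"
  have "(P x y - 8) ^ n = (\<Sum>k\<le>n. ?C k * P x y ^ k)" for x y
    using binomial_ring[of "P x y" "- 8" n] by (simp add: mult_ac)
  then have "(\<Sum>x\<in>U. \<Sum>y\<in>U. (P x y - 8) ^ n) = (\<Sum>x\<in>U. \<Sum>y\<in>U. \<Sum>k\<le>n. ?C k * P x y ^ k)"
    by (simp only:)
  also have "\<dots> = (\<Sum>k\<le>n. ?C k * (\<Sum>x\<in>U. \<Sum>y\<in>U. P x y ^ k))"
    unfolding sum_distrib_left by (rule sum_rotate[symmetric])
  also have "\<dots> \<simeq> (\<Sum>k\<le>n. ?C k * (franel k + 6 * of_bool (k = p - 1)))"
    using n by (intro cong_sum cong_mult cong_refl sum_P_power) auto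
  \<comment> \<open>With \<open>k \<le> n \<le> p - 1\<close> the corner term occurs only for
    \<open>k = n = p - 1\<close>, where the coefficient is 1.\<close>
  also have "(\<Sum>k\<le>n. ?C k * (franel k + 6 * of_bool (k = p - 1)))
      = (\<Sum>k\<le>n. ?C k * franel k + (if k = n then 6 * of_bool (n = p - 1) else 0))"
    using n by (intro sum.cong) (auto simp: algebra_simps)
  also have "\<dots> = Q n + 6 * of_bool (n = p - 1)"
    unfolding Q_def atLeast0AtMost by (simp add: sum.distrib)
  finally show ?thesis .
qed

text \<open>Homogenised geometric sum: times X - m it is X^p - m^p, congruent to X - m by Fermat.
  For X congruent to m it consists of \<open>p\<close> congruent terms.\<close>

lemma geometric_sum_indicator:
  assumes m: "\<not> m \<simeq> 0"
  shows "(\<Sum>n<p. X ^ n * m ^ (p - Suc n)) \<simeq> of_bool (\<not> X \<simeq> m)"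
proof (cases "X \<simeq> m")
  case True
  have "(\<Sum>n<p. X ^ n * m ^ (p - Suc n)) \<simeq> (\<Sum>n<p. m ^ n * m ^ (p - Suc n))"
    using True by (intro cong_sum cong_mult cong_refl cong_pow)
  also have "(\<Sum>n<p. m ^ n * m ^ (p - Suc n)) = (\<Sum>n<p. m ^ (p - 1))"
    by (intro sum.cong) (simp_all flip: power_add)
  also have "\<dots> = int p * m ^ (p - 1)" by simp
  finally show ?thesis using True by (simp add: cong_def)
next
  case False
  have fermat: "x ^ p \<simeq> x" for x
  proof (cases "x \<simeq> 0")
    case True
    then have "x ^ p \<simeq> 0" using p_gt_2 by (simp add: cong_power_0_iff)
    then show ?thesis using True by (simp add: cong_def)
  next
    case False
    have "x ^ p = x * x ^ (p - 1)" using p_gt_2 by (simp flip: power_Suc)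
    also have "\<dots> \<simeq> x * 1" using False by (intro cong_mult cong_refl fermat_little)
    finally show ?thesis by simp
  qed
  have "(X - m) * (\<Sum>n<p. m ^ (p - Suc n) * X ^ n) = X ^ p - m ^ p"
    by (rule power_diff_sumr2[symmetric])
  also have "\<dots> \<simeq> (X - m) * 1" using cong_diff[OF fermat fermat] by simp
  finally have "(X - m) * (\<Sum>n<p. m ^ (p - Suc n) * X ^ n) \<simeq> (X - m) * 1" .
  moreover have "\<not> X - m \<simeq> 0" using False by (simp add: cong_iff_dvd_diff)
  ultimately have "(\<Sum>n<p. m ^ (p - Suc n) * X ^ n) \<simeq> 1" by (blast intro: cong_mult_cancel)
  then show ?thesis using False by (simp add: mult.commute)
qed

text \<open>Multiplied by \<open>x * y\<close>, the equation is quadratic in \<open>y\<close>, and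
  \<open>count_quadratic\<close> applies unless x = -1. There \<open>P\<close> vanishes, so no
  \<open>y\<close> works, while the formula would give 1 + \<chi>(c^2) = 2; this is the correction
  subtracted.\<close>

lemma count_P:
  assumes c: "\<not> c \<simeq> 0" "\<not> c + 1 \<simeq> 0"
  shows "(\<Sum>x\<in>U. \<Sum>y\<in>U. of_bool (P x y \<simeq> c)) = int p - 5 + \<Phi> c"
proof -
  let ?D = "\<lambda>x. ((1 + x)\<^sup>2 - c * x)\<^sup>2 - 4 * x * (1 + x)\<^sup>2"
  have count: "(\<Sum>y\<in>U. of_bool (P x y \<simeq> c)) = 1 + \<chi> (?D x) - 2 * of_bool (- 1 \<simeq> x)" if "x \<in> U" for x
  proof -
    have x: "\<not> x \<simeq> 0" using that by (rule U_not_0)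
    show ?thesis
    proof (cases "- 1 \<simeq> x")
      case True
      then have x1: "x \<simeq> - 1" by (rule cong_sym)
      have "P x y \<simeq> (1 + - 1) * (1 + y) * (1 + (x * y) ^ (p - 2))" for y
        unfolding P_def by (intro cong_mult cong_add cong_refl x1)
      then have "\<not> P x y \<simeq> c" for y using c(1) by (simp add: cong_def)
      moreover have "?D x \<simeq> ((1 + - 1)\<^sup>2 - c * - 1)\<^sup>2 - 4 * - 1 * (1 + - 1)\<^sup>2"
        by (intro cong_intros x1)
      then have "\<chi> (?D x) = 1" using chi_square[OF c(1)] chi_cong[of "?D x" "c\<^sup>2"] by simp
      ultimately show ?thesis using True by simp
    next
      case False
      have a: "\<not> 1 + x \<simeq> 0"
      proof -
        have "- (1 + x) = - 1 - x" by simp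
        then show ?thesis using False by (metis cong_0_iff cong_iff_dvd_diff dvd_minus_iff)
      qed
      have xa: "\<not> x * (1 + x) \<simeq> 0" using x a by (simp only: cong_mult_0_iff) simp
      have iff: "P x y \<simeq> c \<longleftrightarrow> x * (1 + x) * y\<^sup>2 + ((1 + x)\<^sup>2 - c * x) * y + (1 + x) \<simeq> 0"
        if "y \<in> U" for y
      proof -
        have xy: "\<not> x * y \<simeq> 0"
          using x U_not_0[OF that] by (simp only: cong_mult_0_iff) simp
        have "P x y \<simeq> c \<longleftrightarrow> (x * y) * P x y \<simeq> (x * y) * c"
          using cong_mult_cancel[OF xy] cong_scalar_left by blast
        also have "(x * y) * P x y = (1 + x) * (1 + y) * (x * y + x * y * (x * y) ^ (p - 2))"
          by (simp add: P_def algebra_simps)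
        also have "\<dots> \<simeq> (x * y) * c \<longleftrightarrow> (1 + x) * (1 + y) * (x * y + 1) \<simeq> (x * y) * c"
        proof -
          have "(1 + x) * (1 + y) * (x * y + x * y * (x * y) ^ (p - 2))
              \<simeq> (1 + x) * (1 + y) * (x * y + 1)"
            by (intro cong_mult[OF cong_refl] cong_add cong_refl mult_inverse_cong_1 xy)
          then show ?thesis by (simp only: cong_def)
        qed
        also have "\<dots> \<longleftrightarrow> x * (1 + x) * y\<^sup>2 + ((1 + x)\<^sup>2 - c * x) * y + (1 + x) \<simeq> 0"
          by (simp add: cong_iff_dvd_diff power2_eq_square algebra_simps)
        finally show ?thesis .
      qed
      have "(\<Sum>y\<in>U. of_bool (P x y \<simeq> c))
          = (\<Sum>y\<in>U. of_bool (x * (1 + x) * y\<^sup>2 + ((1 + x)\<^sup>2 - c * x) * y + (1 + x) \<simeq> 0) :: int)"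
        using iff by (intro sum.cong) auto
      \<comment> \<open>Adding \<open>y = 0\<close> is harmless: the quadratic takes the nonzero
        value \<open>1 + x\<close> there.\<close>
      also have "\<dots> = (\<Sum>y\<in>R. of_bool (x * (1 + x) * y\<^sup>2 + ((1 + x)\<^sup>2 - c * x) * y + (1 + x) \<simeq> 0))"
        using a by (simp add: sum_R)
      also have "\<dots> = 1 + \<chi> (((1 + x)\<^sup>2 - c * x)\<^sup>2 - 4 * (x * (1 + x)) * (1 + x))"
        by (rule count_quadratic[OF xa])
      also have "4 * (x * (1 + x)) * (1 + x) = 4 * x * (1 + x)\<^sup>2"
        by (simp add: power2_eq_square)
      finally show ?thesis using False by simp
    qed
  qed
  have "(\<Sum>x\<in>U. \<Sum>y\<in>U. of_bool (P x y \<simeq> c)) = (\<Sum>x\<in>U. 1 + \<chi> (?D x) - 2 * of_bool (- 1 \<simeq> x))"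
    by (intro sum.cong count) simp
  also have "\<dots> = (int p - 1) + (\<Sum>x\<in>U. \<chi> (?D x)) - 2 * (\<Sum>x\<in>U. of_bool (- 1 \<simeq> x))"
    using p_gt_2 by (simp add: sum.distrib sum_subtractf sum_distrib_left of_nat_diff)
  \<comment> \<open>The term \<open>x = 0\<close>, equal to 1, is removed from
    \<open>\<Phi> c - 1\<close>.\<close>
  also have "(\<Sum>x\<in>U. \<chi> (?D x)) = \<Phi> c - 2"
    using sum_chi_discriminant[OF c(2)] by (simp add: sum_R chi_1)
  also have "(\<Sum>x\<in>U. of_bool (- 1 \<simeq> x)) = (1 :: int)"
  proof -
    have "\<not> - 1 \<simeq> 0" using p_gt_2 by (simp add: cong_iff_dvd_diff)
    then show ?thesis using sum_indicator[of "- 1" "\<lambda>_. 1"] by (simp add: sum_R)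
  qed
  finally show ?thesis by simp
qed

text \<open>Counting pairs off the curve gives (p - 1)^2 - (p - 5 + \<Phi>) = p(p - 3) + 6 - \<Phi>,
  and this 6 cancels the corner contribution at \<open>n = p - 1\<close>.\<close>

lemma sum_Q_cong:
  assumes m: "\<not> m \<simeq> 0" "\<not> m + 8 \<simeq> 0" "\<not> m + 9 \<simeq> 0"
  shows "(\<Sum>n<p. Q n * m ^ (p - Suc n)) \<simeq> - \<Phi> (m + 8)"
proof -
  have "(\<Sum>n<p. \<Sum>x\<in>U. \<Sum>y\<in>U. (P x y - 8) ^ n * m ^ (p - Suc n))
      = (\<Sum>n<p. (\<Sum>x\<in>U. \<Sum>y\<in>U. (P x y - 8) ^ n) * m ^ (p - Suc n))"
    by (simp only: sum_distrib_right)
  also have "\<dots> \<simeq> (\<Sum>n<p. (Q n + 6 * of_bool (n = p - 1)) * m ^ (p - Suc n))"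
    using p_gt_2 by (intro cong_sum cong_mult cong_refl sum_P_minus_8_power) auto
  also have "(\<Sum>n<p. (Q n + 6 * of_bool (n = p - 1)) * m ^ (p - Suc n))
      = (\<Sum>n<p. Q n * m ^ (p - Suc n) + (if n = p - 1 then 6 else 0))"
    using p_gt_2 by (intro sum.cong) (auto simp: distrib_right)
  also have "\<dots> = (\<Sum>n<p. Q n * m ^ (p - Suc n)) + 6"
    using p_gt_2 by (simp add: sum.distrib)
  finally have 1: "(\<Sum>n<p. \<Sum>x\<in>U. \<Sum>y\<in>U. (P x y - 8) ^ n * m ^ (p - Suc n))
      \<simeq> (\<Sum>n<p. Q n * m ^ (p - Suc n)) + 6" .
  have "(\<Sum>n<p. \<Sum>x\<in>U. \<Sum>y\<in>U. (P x y - 8) ^ n * m ^ (p - Suc n))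
      = (\<Sum>x\<in>U. \<Sum>y\<in>U. \<Sum>n<p. (P x y - 8) ^ n * m ^ (p - Suc n))"
    by (rule sum_rotate)
  also have "\<dots> \<simeq> (\<Sum>x\<in>U. \<Sum>y\<in>U. of_bool (\<not> P x y - 8 \<simeq> m))"
    by (intro cong_sum geometric_sum_indicator m)
  also have "(\<Sum>x\<in>U. \<Sum>y\<in>U. of_bool (\<not> P x y - 8 \<simeq> m))
      = (\<Sum>x\<in>U. \<Sum>y\<in>U. 1 - of_bool (P x y \<simeq> m + 8) :: int)"
    by (intro sum.cong) (auto simp: cong_iff_dvd_diff algebra_simps)
  also have "\<dots> = (int p - 1)\<^sup>2 - (\<Sum>x\<in>U. \<Sum>y\<in>U. of_bool (P x y \<simeq> m + 8))"
    using p_gt_2 by (simp add: sum_subtractf power2_eq_square of_nat_diff)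
  also have "\<dots> = int p * (int p - 3) + 6 - \<Phi> (m + 8)"
    using m by (subst count_P) (simp_all add: power2_eq_square algebra_simps)
  finally have "(\<Sum>n<p. Q n * m ^ (p - Suc n)) + 6 \<simeq> int p * (int p - 3) + 6 - \<Phi> (m + 8)"
    using 1 by (blast intro: cong_trans cong_sym)
  then have "(\<Sum>n<p. Q n * m ^ (p - Suc n)) \<simeq> int p * (int p - 3) - \<Phi> (m + 8)"
    by (simp add: cong_iff_dvd_diff algebra_simps)
  moreover have "int p * (int p - 3) - \<Phi> (m + 8) \<simeq> 0 - \<Phi> (m + 8)"
    by (intro cong_diff cong_refl) (simp add: cong_0_iff)
  ultimately show ?thesis by (auto intro: cong_trans)
qed

end

section \<open>Congruences between rationals with denominator prime to \<open>p\<close>\<close>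

lemma p_integral_iff:
  assumes "prime p"
  shows "x \<in> p_integral p \<longleftrightarrow> (\<exists>a b. coprime b (int p) \<and> x = of_int a / of_int b)"
proof
  assume x: "x \<in> p_integral p"
  obtain n d where nd: "quotient_of x = (n, d)" by (cases "quotient_of x")
  then have "coprime d (int p)" "x = of_int n / of_int d"
    using x quotient_of_div by (auto simp: p_integral_def)
  then show "\<exists>a b. coprime b (int p) \<and> x = of_int a / of_int b" by blast
next
  assume "\<exists>a b. coprime b (int p) \<and> x = of_int a / of_int b"
  then obtain a b where b: "coprime b (int p)" and x: "x = of_int a / of_int b" by blast
  obtain n d where nd: "quotient_of x = (n, d)" by (cases "quotient_of x")
  have d: "d > 0" "coprime n d" "x = of_int n / of_int d"
    using nd quotient_of_denom_pos quotient_of_coprime quotient_of_div by blast+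
  have "b \<noteq> 0" using b prime_gt_1_nat[OF assms] by auto
  then have "of_int (n * b) = (of_int (a * d) :: rat)"
    using x d by (simp add: field_simps)
  then have "n * b = a * d" by (simp only: of_int_eq_iff)
  then have "d dvd n * b" by simp
  \<comment> \<open>The reduced denominator divides every other one, so it inherits coprimality to
    \<open>p\<close>.\<close>
  then have "d dvd b" using d(2) by (simp add: coprime_dvd_mult_right_iff coprime_commute)
  then have "coprime d (int p)" using b by (blast intro: coprime_divisors[OF _ dvd_refl])
  then show "x \<in> p_integral p" by (simp add: p_integral_def nd)
qed

lemma p_integral_diff:
  assumes "prime p" "x \<in> p_integral p" "y \<in> p_integral p"
  shows "x - y \<in> p_integral p"
proof -
  obtain a b c d where ab: "coprime b (int p)" "x = of_int a / of_int b"
    and cd: "coprime d (int p)" "y = of_int c / of_int d"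
    using assms by (auto simp: p_integral_iff)
  have "b \<noteq> 0" "d \<noteq> 0" using ab cd prime_gt_1_nat[OF assms(1)] by auto
  then have "x - y = of_int (a * d - c * b) / of_int (b * d)"
    by (simp add: ab cd diff_frac_eq)
  moreover have "coprime (b * d) (int p)" using ab cd by simp
  ultimately show ?thesis unfolding p_integral_iff[OF assms(1)] by blast
qed

lemma rat_cong_trans_left:
  assumes "prime p" "rat_cong x z p" "rat_cong y z p"
  shows "rat_cong x y p"
proof -
  obtain s t where "s \<in> p_integral p" "x - z = of_nat p * s" "t \<in> p_integral p" "y - z = of_nat p * t"
    using assms by (auto simp: rat_cong_def)
  then have "s - t \<in> p_integral p" "x - y = of_nat p * (s - t)"
    using p_integral_diff[OF assms(1)] by (auto simp: algebra_simps)
  then show ?thesis using assms by (auto simp: rat_cong_def)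
qed

lemma rat_cong_fraction:
  assumes "prime p" and b: "coprime b (int p)" and "[a = r * b] (mod int p)"
  shows "rat_cong (of_int a / of_int b) (of_int r) p"
proof -
  obtain k where k: "a - r * b = int p * k"
    using assms(3) by (auto simp: cong_iff_dvd_diff elim: dvdE)
  have "b \<noteq> 0" using b prime_gt_1_nat[OF assms(1)] by auto
  have "of_int a = of_nat p * of_int k + (of_int r * of_int b :: rat)"
    using arg_cong[OF k, of "of_int :: int \<Rightarrow> rat"] by simp
  then have diff: "of_int a / of_int b - of_int r = of_nat p * (of_int k / of_int b :: rat)"
    using \<open>b \<noteq> 0\<close> by (simp add: field_simps)
  have frac: "of_int c / of_int b \<in> p_integral p" for c
    unfolding p_integral_iff[OF assms(1)] using b by blast
  have "of_int r / of_int 1 \<in> p_integral p"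
    unfolding p_integral_iff[OF assms(1)] using coprime_1_left by blast
  then have "of_int r \<in> p_integral p" by simp
  with frac diff show ?thesis unfolding rat_cong_def by blast
qed

text \<open>Over the common denominator \<open>m ^ (p - 1)\<close>, congruent to 1 by Fermat, the
  numerator is the integer sum of \<open>sum_Q_cong\<close>.\<close>

lemma rat_cong_sum_Q:
  assumes "prime p" "p > 2" and m: "\<not> int p dvd m"
    and A: "[(\<Sum>n<p. Q n * m ^ (p - Suc n)) = r] (mod int p)"
  shows "rat_cong (\<Sum>n=0..p-1. of_int (Q n) / of_int m ^ n) (of_int r) p"
proof -
  interpret odd_prime p by unfold_locales fact+
  have m0: "m \<noteq> 0" using m by auto
  have one: "m ^ (p - 1) \<simeq> 1" using m by (intro fermat_little) (simp add: cong_0_iff)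
  have "(\<Sum>n=0..p-1. of_int (Q n) / of_int m ^ n)
      = (\<Sum>n<p. of_int (Q n * m ^ (p - Suc n)) / (of_int (m ^ (p - 1)) :: rat))"
  proof (rule sum.cong)
    fix n assume "n \<in> {..<p}"
    then have "m ^ (p - 1) = m ^ n * m ^ (p - Suc n)" by (simp flip: power_add)
    then show "of_int (Q n) / of_int m ^ n = of_int (Q n * m ^ (p - Suc n)) / (of_int (m ^ (p - 1)) :: rat)"
      using m0 by simp
  qed (use p_gt_2 in auto)
  also have "\<dots> = of_int (\<Sum>n<p. Q n * m ^ (p - Suc n)) / of_int (m ^ (p - 1))"
    by (simp only: sum_divide_distrib of_int_sum)
  also have "rat_cong \<dots> (of_int r) p"
  proof (rule rat_cong_fraction[OF prime_p])
    have "coprime m (int p)"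
      using m prime_int_p by (metis coprime_commute prime_imp_coprime)
    then show "coprime (m ^ (p - 1)) (int p)" by simp
    have "r * 1 \<simeq> r * m ^ (p - 1)" by (intro cong_mult cong_refl cong_sym[OF one])
    then show "(\<Sum>n<p. Q n * m ^ (p - Suc n)) \<simeq> r * m ^ (p - 1)"
      using A by (auto intro: cong_trans)
  qed
  finally show ?thesis .
qed

section \<open>Evaluation at -6 and -12 and identification of \<open>- \<phi> 1\<close>\<close>

theorem theorem5p2:
  fixes p :: nat
  assumes "prime p" and "p > 3"
  shows "rat_cong (\<Sum>n=0..p-1. of_int (Q n) / (-6) ^ n) (\<Sum>n=0..p-1. of_int (Q n) / (-12) ^ n) p
    \<and> (\<forall>u v :: int. 3 dvd p - 1 \<and> int p = u\<^sup>2 + 3 * v\<^sup>2 \<and> 3 dvd u - 1 \<longrightarrow>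
         rat_cong (\<Sum>n=0..p-1. of_int (Q n) / (-12) ^ n) (of_int (2 * u)) p)
    \<and> ([p = 2] (mod 3) \<longrightarrow>
         rat_cong (\<Sum>n=0..p-1. of_int (Q n) / (-12) ^ n) 0 p)"
proof -
  have p2: "p > 2" using assms by simp
  interpret odd_prime p by unfold_locales (use assms in auto)
  have 2: "\<not> 2 \<simeq> 0" and 3: "\<not> 3 \<simeq> 0" using assms by (simp_all add: cong_0_iff zdvd_not_zless)
  \<comment> \<open>Up to sign, m, m + 8 and m + 9 are 6, 2, 3 for m = -6 and 12, 4, 3 for m = -12,
    all of this form.\<close>
  have nz: "\<not> 2 ^ i * 3 ^ j \<simeq> 0" for i j
    using 2 3 prime_int_p by (auto simp: cong_0_iff prime_dvd_mult_iff dest: prime_dvd_power[OF prime_int_p])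
  have "(\<Sum>n<p. Q n * (- 6) ^ (p - Suc n)) \<simeq> - \<Phi> (- 6 + 8)"
    by (rule sum_Q_cong) (use nz[of 1 1] nz[of 1 0] nz[of 0 1] in \<open>simp_all add: cong_0_iff\<close>)
  then have six: "rat_cong (\<Sum>n=0..p-1. of_int (Q n) / (- 6) ^ n) (of_int (- \<phi> 1)) p"
    using rat_cong_sum_Q[OF assms(1) p2, of "- 6" "- \<phi> 1"] nz[of 1 1] Phi_2[OF assms(2)]
    by (simp add: cong_0_iff)
  have "(\<Sum>n<p. Q n * (- 12) ^ (p - Suc n)) \<simeq> - \<Phi> (- 12 + 8)"
    by (rule sum_Q_cong) (use nz[of 2 1] nz[of 2 0] nz[of 0 1] in \<open>simp_all add: cong_0_iff\<close>)
  then have twelve: "rat_cong (\<Sum>n=0..p-1. of_int (Q n) / (- 12) ^ n) (of_int (- \<phi> 1)) p"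
    using rat_cong_sum_Q[OF assms(1) p2, of "- 12" "- \<phi> 1"] nz[of 2 1] Phi_minus_4
    by (simp add: cong_0_iff)
  have "- \<phi> 1 = 2 * u" if dv: "3 dvd p - 1" and uv: "int p = u\<^sup>2 + 3 * v\<^sup>2" and u: "3 dvd u - 1" for u v
  proof -
    obtain l w where l: "\<phi> 1 = 2 * l" "int p = l\<^sup>2 + 3 * w\<^sup>2" "[l = - 1] (mod 3)"
      by (rule phi_1_representation[OF assms(2) dv])
    have "u\<^sup>2 = l\<^sup>2" by (rule prime_square_plus_3_square_unique[OF prime_int_p uv l(2)])
    then consider "u = l" | "u = - l" by (auto simp: power2_eq_iff)
    then show ?thesis
    proof cases
      \<comment> \<open>This case is contradictory: \<open>u\<close> is 1 and \<open>l\<close> is -1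
        modulo 3.\<close>
      case 1
      then show ?thesis using u l(3) unfolding cong_iff_dvd_diff by presburger
    qed (simp add: l)
  qed
  then show ?thesis
    using rat_cong_trans_left[OF assms(1) six twelve] twelve phi_1_eq_0 by (metis minus_zero of_int_0)
qed

end
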